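(* Let $\mathbb{G}=(V,E)$ be a coloured ribbon graph with vertex colouring $\mathcal{V}$ and boundary colouring $\mathcal{B}$, and let $U$ be the function from coloured ribbon graphs to $\mathbb{Z}[\alpha,\beta,\gamma,a_{\mathrm{bs}},a_{\mathrm{bp}}^{1/2},a_{\mathrm{olc}},a_{\mathrm{olh}}^{1/2},b_{\mathrm{bs}},b_{\mathrm{bp}}^{1/2},b_{\mathrm{olc}},b_{\mathrm{olh}}^{1/2}]$ defined (see context) by the edge-type recursion. Then $$U(\mathbb{G})=\alpha^{k(\mathbb{G}/\mathcal{V})}\beta^{k(\mathbb{G}^*/\mathcal{B})}\gamma^{v(\mathbb{G})}(\alpha a_{\mathrm{bs}})^{r_1(\mathbb{G})}a_{\mathrm{bp}}^{r_2(\mathbb{G})}a_{\mathrm{olc}}^{r_3(\mathbb{G})}a_{\mathrm{olh}}^{r_4(\mathbb{G})}\sum_{A\subseteq E}\Big(\frac{b_{\mathrm{bs}}}{\alpha\gamma a_{\mathrm{bs}}}\Big)^{r_1(A)}\Big(\frac{b_{\mathrm{bp}}}{\gamma a_{\mathrm{bp}}}\Big)^{r_2(A)}\Big(\frac{\beta\gamma b_{\mathrm{olc}}}{a_{\mathrm{olc}}}\Big)^{r_3(A)}\Big(\frac{\gamma b_{\mathrm{olh}}}{a_{\mathrm{olh}}}\Big)^{r_4(A)},$$ where $r_1(A)=r_{\mathbb{G}/\mathcal{V}}(A)$, $r_2(A)=\rho(A)-r_{\mathbb{G}/\mathcal{V}}(A)$, $r_3(A)=r_{\mathbb{G}^*/\mathcal{B}}(E)-r_{\mathbb{G}^*/\mathcal{B}}(E\setminus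 A)$, $r_4(A)=|A|+r_{\mathbb{G}^*/\mathcal{B}}(E\setminus A)-r_{\mathbb{G}^*/\mathcal{B}}(E)-\rho(A)$, and $r_i(\mathbb{G}):=r_i(E)$.
   Context: A ribbon graph $\mathbb{G}=(V,E)$ is a surface with boundary represented as a union of two finite sets of closed discs, vertices and edges, meeting in disjoint line segments, each on the boundary of exactly one vertex and one edge, each edge containing exactly two such segments; $F(\mathbb{G})$ is its set of boundary components. A loop is an edge meeting one vertex; non-orientable if its union with the vertex is a Möbius band, orientable otherwise. Deletion $\mathbb{G}\backslash e$ removes $e$; contraction $\mathbb{G}/e$ glues a disc (new vertex) along each boundary component of $e\cup u\cup v$ ($u,v$ the ends of $e$) and removes $e,u,v$ (non-loop: ends merge; non-orientable loop: one new vertex; orientable loop: two new vertices; boundary components unchanged). $e^c=E\setminus\{e\}$; deleting/contracting a set is done edge by edge. A coloured ribbon graph has a partition $\mathcal{V}$ of $V$ into vertex colour classes and a partition $\mathcal{B}$ of $F(\mathbb{G})$ into boundary colour classes. Contraction of $e$: boundary classes unchanged; if distinct ends $u,v$ merge into $p$, the classes of $u$ and $v$ merge into one class containing $p$ (and not $u,v$); if $e$ is a non-orientable loop at $u$ producing $p$, $p$ replaces $u$ in its class; if $e$ is an orientable loop at $u$ producing $p,q$, both replace $u$ in its class. Deletion of $e$: vertex classes unchanged; if $e$ meets distinct boundary components $a,b$ merging into $r$, their classes merge into one class containing $r$; if $e$ meets one boundary component $a$, the resulting one component $r$, or two components $r,s$, replace $a$ in its class. Other vertices/boundary components keep their classes.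 Edge types: $\mathrm{bs}$ = one edge joining two distinct vertices in different vertex colour classes; $\mathrm{bp}$ = one edge joining two distinct vertices of the same vertex colour class; $\mathrm{olc}$ = one vertex with an orientable loop, its two boundary components in different boundary colour classes; $\mathrm{olh}$ = as $\mathrm{olc}$ but the two boundary components in the same class; $\mathrm{nl}$ = one vertex with a non-orientable loop. Edge $e$ has type $(i,j)$ if after removing isolated vertices $\mathbb{G}/e^c=i$ and $\mathbb{G}\backslash e^c=j$. The function $U$ is defined by $U(\mathbb{G})=a_iU(\mathbb{G}\backslash e)+b_jU(\mathbb{G}/e)$ whenever $e$ is of type $(i,j)$, and $U(\mathbb{G})=\alpha^n\beta^m\gamma^v$ if $\mathbb{G}$ is edgeless with $v$ vertices, $n$ vertex colour classes and $m$ boundary colour classes, where $a_{\mathrm{nl}}=a_{\mathrm{bp}}^{1/2}a_{\mathrm{olh}}^{1/2}$, $b_{\mathrm{nl}}=b_{\mathrm{bp}}^{1/2}b_{\mathrm{olh}}^{1/2}$. Parameters: $v(\mathbb{G})=|V|$. For a graph $H$ and edge set $A$, $r_H(A)$ is the rank (number of vertices minus number of components) of the spanning subgraph of $H$ with edge set $A$, and $k(H)$ is the number of components of $H$. For $A\subseteq E$, $b(A)$ is the number of boundary components of the ribbon subgraph $(V,A)$ and $\rho(A)=\frac12(|A|+|V|-b(A))$ (equivalently $r(A)+\frac12\gamma(A)$, with $\gamma$ the Euler genus). $\mathbb{G}/\mathcal{V}$ is the graph whose vertices are the vertex colour classes, with one edge for each edge of $\mathbb{G}$ joining the classes of its ends.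 $\mathbb{G}^*/\mathcal{B}$ is the graph whose vertices are the boundary colour classes, with one edge for each edge $e$ of $\mathbb{G}$ joining the classes of the boundary components of $\mathbb{G}$ touching $e$. *)

theory Defs
  imports
    "HOL-Library.Poly_Mapping"
    "HOL-Library.Disjoint_Sets"
    "HOL-Computational_Algebra.Polynomial_Factorial"
begin

section \<open>Multigraphs\<close>

text \<open>The classes of \<open>W\<close> under the equivalence relation generated by \<open>R\<close> (for \<open>R \<subseteq> W \<times> W\<close>).\<close>

definition components :: "'w set \<Rightarrow> ('w \<times> 'w) set \<Rightarrow> 'w set set" where
  "components W R = W // {(x, y). x \<in> W \<and> y \<in> W \<and> (x, y) \<in> (R \<union> R\<inverse>)\<^sup>*}"

text \<open>Loops and multiple edges are allowed: \<open>mends a\<close> is the set of the (one or two) ends of \<open>a\<close>.\<close>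

record ('w, 'e) multigraph =
  mverts :: "'w set"
  medges :: "'e set"
  mends :: "'e \<Rightarrow> 'w set"

definition mcomponents :: "('w, 'e) multigraph \<Rightarrow> 'e set \<Rightarrow> 'w set set" where
  "mcomponents H A = components (mverts H) {(x, y). \<exists>a\<in>A. x \<in> mends H a \<and> y \<in> mends H a}"

definition num_components :: "('w, 'e) multigraph \<Rightarrow> nat" where
  "num_components H = card (mcomponents H (medges H))"

definition graph_rank :: "('w, 'e) multigraph \<Rightarrow> 'e set \<Rightarrow> int" where
  "graph_rank H A = int (card (mverts H)) - int (card (mcomponents H A))"


section \<open>Ribbon graphs\<close>

text \<open>
  A ribbon graph is encoded by the cell structure of the boundaries of its discs. On the
  boundary circle of each vertex disc finitely many, and at least one, disjoint closed segments are
  chosen, called slots. \<open>pts\<close> is the set of endpoints of slots; \<open>slot\<close> exchanges the two endpoints of a slot;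
  \<open>arc\<close> exchanges the two endpoints of a component of the complement of the slots in the boundary
  of a vertex disc. So the boundary circle of a vertex disc is an orbit of \<open>arc\<close> and \<open>slot\<close>, along
  which the two alternate.

  Each edge disc is attached along exactly two slots, its two common line segments with vertices.
  \<open>att\<close> is the set of endpoints of slots to which an edge disc is attached; the complement of its
  two slots in the boundary of an edge disc consists of two sides, and \<open>side\<close> exchanges the two
  endpoints of a side. Thus the boundary of an edge disc is the circle
  \<open>x, slot x, side (slot x), side x\<close>, and the edge is identified with this set of four points.

  Slots without an edge disc are just part of the boundary of the surface. They are what allows
  isolated vertices (whose slots are all vacant); a ribbon graph is represented many times,
  with different vacant slots.
\<close>

record 'p ribbon_graph =
  pts :: "'p set"
  arc :: "'p \<Rightarrow> 'p"
  slot :: "'p \<Rightarrow> 'p"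
  att :: "'p set"
  side :: "'p \<Rightarrow> 'p"

definition ribbon_graph :: "('p, 'z) ribbon_graph_scheme \<Rightarrow> bool" where
  "ribbon_graph G \<longleftrightarrow>
     finite (pts G) \<and> att G \<subseteq> pts G \<and>
     (\<forall>x\<in>pts G. arc G x \<in> pts G \<and> arc G x \<noteq> x \<and> arc G (arc G x) = x) \<and>
     (\<forall>x\<in>pts G. slot G x \<in> pts G \<and> slot G x \<noteq> x \<and> slot G (slot G x) = x) \<and>
     (\<forall>x\<in>att G. slot G x \<in> att G) \<and>
     (\<forall>x\<in>att G. side G x \<in> att G \<and> side G x \<noteq> x \<and> side G x \<noteq> slot G x \<and>
        side G (side G x) = x \<and> side G (slot G x) = slot G (side G x))"

text \<open>Vertices and boundary components are identified with the sets of points on their circles.\<close>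

definition verts :: "('p, 'z) ribbon_graph_scheme \<Rightarrow> 'p set set" where
  "verts G = components (pts G) ({(x, arc G x) |x. x \<in> pts G} \<union> {(x, slot G x) |x. x \<in> pts G})"

definition edges :: "('p, 'z) ribbon_graph_scheme \<Rightarrow> 'p set set" where
  "edges G = {{x, slot G x, side G x, slot G (side G x)} |x. x \<in> att G}"

text \<open>The boundary of the surface consists of the arcs, the sides of edges and the vacant slots.\<close>

definition bnds :: "('p, 'z) ribbon_graph_scheme \<Rightarrow> 'p set set" where
  "bnds G = components (pts G)
     ({(x, arc G x) |x. x \<in> pts G} \<union> {(x, side G x) |x. x \<in> att G} \<union>
      {(x, slot G x) |x. x \<in> pts G - att G})"

text \<open>The ribbon subgraph \<open>(V, A)\<close>.\<close>

definition ribbon_subgraph :: "('p, 'z) ribbon_graph_scheme \<Rightarrow> 'p set set \<Rightarrow> ('p, 'z) ribbon_graph_scheme"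
  where "ribbon_subgraph G A = G\<lparr>att := \<Union>A\<rparr>"

definition rho :: "('p, 'z) ribbon_graph_scheme \<Rightarrow> 'p set set \<Rightarrow> rat" where
  "rho G A = (of_nat (card A) + of_nat (card (verts G)) - of_nat (card (bnds (ribbon_subgraph G A)))) / 2"

definition ends :: "('p, 'z) ribbon_graph_scheme \<Rightarrow> 'p set \<Rightarrow> 'p set set" where
  "ends G e = {v \<in> verts G. v \<inter> e \<noteq> {}}"

definition touching :: "('p, 'z) ribbon_graph_scheme \<Rightarrow> 'p set \<Rightarrow> 'p set set" where
  "touching G e = {f \<in> bnds G. f \<inter> e \<noteq> {}}"

text \<open>
  The union of a loop \<open>e\<close> and its vertex (an annulus or a Moebius band) is orientable iff the
  two discs can be oriented coherently. An orientation of a disc selects the initial point of each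
  slot on its boundary. Coherent orientations induce opposite directions on a common segment, so
  they are recorded by one predicate \<open>s\<close> (being initial for the direction induced by the vertex disc),
  which changes along every arc, slot and side.
\<close>

definition loop :: "('p, 'z) ribbon_graph_scheme \<Rightarrow> 'p set \<Rightarrow> bool" where
  "loop G e \<longleftrightarrow> card (ends G e) = 1"

definition orientable_loop :: "('p, 'z) ribbon_graph_scheme \<Rightarrow> 'p set \<Rightarrow> bool" where
  "orientable_loop G e \<longleftrightarrow> loop G e \<and>
     (\<exists>s :: 'p \<Rightarrow> bool.
        (\<forall>x\<in>\<Union>(ends G e). s (arc G x) \<noteq> s x \<and> s (slot G x) \<noteq> s x) \<and>
        (\<forall>x\<in>e. s (side G x) \<noteq> s x))"

definition nonorientable_loop :: "('p, 'z) ribbon_graph_scheme \<Rightarrow> 'p set \<Rightarrow> bool" where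
  "nonorientable_loop G e \<longleftrightarrow> loop G e \<and> \<not> orientable_loop G e"


section \<open>Coloured ribbon graphs, deletion and contraction\<close>

record 'p coloured_ribbon_graph = "'p ribbon_graph" +
  vclasses :: "'p set set set"
  bclasses :: "'p set set set"

definition coloured_ribbon_graph :: "'p coloured_ribbon_graph \<Rightarrow> bool" where
  "coloured_ribbon_graph G \<longleftrightarrow> ribbon_graph G \<and>
     partition_on (verts G) (vclasses G) \<and> partition_on (bnds G) (bclasses G)"

text \<open>Merge the classes that contain an element of \<open>old\<close>, and in the result replace \<open>old\<close> by \<open>new\<close>.\<close>

definition replace_in :: "'a set set \<Rightarrow> 'a set \<Rightarrow> 'a set \<Rightarrow> 'a set set" where
  "replace_in P old new =
     insert (\<Union>{C \<in> P. C \<inter> old \<noteq> {}} - old \<union> new) {C \<in> P. C \<inter> old = {}}"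

text \<open>
  Deleting \<open>e\<close> vacates its two slots. The vertices stay the same sets of points, and so do
  the boundary components not touched by \<open>e\<close>; the new boundary components are those through the
  points of \<open>e\<close>.
\<close>

definition delete :: "'p coloured_ribbon_graph \<Rightarrow> 'p set \<Rightarrow> 'p coloured_ribbon_graph" where
  "delete G e = (let H = G\<lparr>att := att G - e\<rparr> in
     H\<lparr>bclasses := replace_in (bclasses G) (touching G e) (touching H e)\<rparr>)"

text \<open>
  The boundary components of the union of \<open>e\<close> and its ends \<open>u\<close>, \<open>v\<close> consist of the two sides of \<open>e\<close>
  and the boundary of \<open>u\<close> and \<open>v\<close> without the two slots of \<open>e\<close>. They bound the new vertex
  discs, on which the two sides of \<open>e\<close> are vacant slots. The boundary components of the surface stay the
  same sets of points.
\<close>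

definition contract :: "'p coloured_ribbon_graph \<Rightarrow> 'p set \<Rightarrow> 'p coloured_ribbon_graph" where
  "contract G e =
     (let H = G\<lparr>slot := (\<lambda>x. if x \<in> e then side G x else slot G x), att := att G - e\<rparr> in
      H\<lparr>vclasses := replace_in (vclasses G) (ends G e) (ends H e)\<rparr>)"

text \<open>The graphs \<open>G/V\<close> and \<open>G\<^sup>*/B\<close>.\<close>

definition vertex_quotient :: "'p coloured_ribbon_graph \<Rightarrow> ('p set set, 'p set) multigraph" where
  "vertex_quotient G = \<lparr>mverts = vclasses G, medges = edges G,
     mends = (\<lambda>e. {C \<in> vclasses G. C \<inter> ends G e \<noteq> {}})\<rparr>"

definition boundary_quotient :: "'p coloured_ribbon_graph \<Rightarrow> ('p set set, 'p set) multigraph" where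
  "boundary_quotient G = \<lparr>mverts = bclasses G, medges = edges G,
     mends = (\<lambda>e. {C \<in> bclasses G. C \<inter> touching G e \<noteq> {}})\<rparr>"

definition r1 :: "'p coloured_ribbon_graph \<Rightarrow> 'p set set \<Rightarrow> int" where
  "r1 G A = graph_rank (vertex_quotient G) A"

definition r2 :: "'p coloured_ribbon_graph \<Rightarrow> 'p set set \<Rightarrow> rat" where
  "r2 G A = rho G A - of_int (graph_rank (vertex_quotient G) A)"

definition r3 :: "'p coloured_ribbon_graph \<Rightarrow> 'p set set \<Rightarrow> int" where
  "r3 G A = graph_rank (boundary_quotient G) (edges G) - graph_rank (boundary_quotient G) (edges G - A)"

definition r4 :: "'p coloured_ribbon_graph \<Rightarrow> 'p set set \<Rightarrow> rat" where
  "r4 G A = of_nat (card A) + of_int (graph_rank (boundary_quotient G) (edges G - A))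
     - of_int (graph_rank (boundary_quotient G) (edges G)) - rho G A"


section \<open>Edge types\<close>

datatype etype = Bs | Bp | Olc | Olh | Nl

definition same_class :: "'a set set \<Rightarrow> 'a set \<Rightarrow> bool" where
  "same_class P S \<longleftrightarrow> (\<exists>C\<in>P. S \<subseteq> C)"

text \<open>
  \<open>H\<close> has the single edge \<open>e\<close> and is of type \<open>t\<close> once its isolated vertices are removed: the
  remaining vertices and boundary components are those that meet \<open>e\<close>.
\<close>

definition one_edge_type :: "'p coloured_ribbon_graph \<Rightarrow> 'p set \<Rightarrow> etype \<Rightarrow> bool" where
  "one_edge_type H e t \<longleftrightarrow> edges H = {e} \<and>
     (case t of
        Bs \<Rightarrow> card (ends H e) = 2 \<and> \<not> same_class (vclasses H) (ends H e)
      | Bp \<Rightarrow> card (ends H e) = 2 \<and> same_class (vclasses H) (ends H e)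
      | Olc \<Rightarrow> orientable_loop H e \<and> \<not> same_class (bclasses H) (touching H e)
      | Olh \<Rightarrow> orientable_loop H e \<and> same_class (bclasses H) (touching H e)
      | Nl \<Rightarrow> nonorientable_loop H e)"

text \<open>The edges other than \<open>e\<close> are contracted, respectively deleted, one after the other.\<close>

definition edge_type :: "'p coloured_ribbon_graph \<Rightarrow> 'p set \<Rightarrow> etype \<Rightarrow> etype \<Rightarrow> bool" where
  "edge_type G e i j \<longleftrightarrow> e \<in> edges G \<and>
     (\<exists>fs. distinct fs \<and> set fs = edges G - {e} \<and> one_edge_type (foldl contract G fs) e i) \<and>
     (\<exists>fs. distinct fs \<and> set fs = edges G - {e} \<and> one_edge_type (foldl delete G fs) e j)"


section \<open>The coefficient ring and the recursion\<close>

datatype var = Alpha | Beta | Sqrt_gamma | A_bs | Sqrt_a_bp | A_olc | Sqrt_a_olh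
  | B_bs | Sqrt_b_bp | B_olc | Sqrt_b_olh

primrec var_index :: "var \<Rightarrow> nat" where
  "var_index Alpha = 0" | "var_index Beta = 1" | "var_index Sqrt_gamma = 2"
| "var_index A_bs = 3" | "var_index Sqrt_a_bp = 4" | "var_index A_olc = 5"
| "var_index Sqrt_a_olh = 6" | "var_index B_bs = 7" | "var_index Sqrt_b_bp = 8"
| "var_index B_olc = 9" | "var_index Sqrt_b_olh = 10"

lemma var_index_inject: "var_index x = var_index y \<Longrightarrow> x = y"
  by (cases x; cases y; simp)

text \<open>The order only serves to make the polynomial ring an instance of \<open>idom\<close>.\<close>

instantiation var :: linorder
begin

definition less_eq_var :: "var \<Rightarrow> var \<Rightarrow> bool" where
  "x \<le> y \<longleftrightarrow> var_index x \<le> var_index y"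

definition less_var :: "var \<Rightarrow> var \<Rightarrow> bool" where
  "x < y \<longleftrightarrow> var_index x < var_index y"

instance
  by standard (auto simp: less_eq_var_def less_var_def intro: var_index_inject)

end

type_synonym upoly = "(var \<Rightarrow>\<^sub>0 nat) \<Rightarrow>\<^sub>0 int"

definition indet :: "var \<Rightarrow> upoly" where
  "indet x = Poly_Mapping.single (Poly_Mapping.single x 1) 1"

abbreviation "alpha \<equiv> indet Alpha"
abbreviation "beta \<equiv> indet Beta"
abbreviation "sqrt_gamma \<equiv> indet Sqrt_gamma"
abbreviation "gamma \<equiv> sqrt_gamma ^ 2"
abbreviation "a_bs \<equiv> indet A_bs"
abbreviation "sqrt_a_bp \<equiv> indet Sqrt_a_bp"
abbreviation "a_olc \<equiv> indet A_olc"
abbreviation "sqrt_a_olh \<equiv> indet Sqrt_a_olh"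
abbreviation "b_bs \<equiv> indet B_bs"
abbreviation "sqrt_b_bp \<equiv> indet Sqrt_b_bp"
abbreviation "b_olc \<equiv> indet B_olc"
abbreviation "sqrt_b_olh \<equiv> indet Sqrt_b_olh"

text \<open>
  The square root of \<open>gamma\<close> is adjoined because single factors of the state sum are half-integral
  powers of expressions containing \<open>gamma\<close>. The ring in which \<open>U\<close> takes its values, generated by
  \<open>gamma\<close> and the other ten indeterminates, consists of the polynomials in which
  the square root of \<open>gamma\<close> has only even exponents.
\<close>

definition U_ring :: "upoly set" where
  "U_ring = {p. \<forall>m\<in>Poly_Mapping.keys p. even (Poly_Mapping.lookup m Sqrt_gamma)}"

primrec coeff_a :: "etype \<Rightarrow> upoly" where
  "coeff_a Bs = a_bs"
| "coeff_a Bp = sqrt_a_bp ^ 2"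
| "coeff_a Olc = a_olc"
| "coeff_a Olh = sqrt_a_olh ^ 2"
| "coeff_a Nl = sqrt_a_bp * sqrt_a_olh"

primrec coeff_b :: "etype \<Rightarrow> upoly" where
  "coeff_b Bs = b_bs"
| "coeff_b Bp = sqrt_b_bp ^ 2"
| "coeff_b Olc = b_olc"
| "coeff_b Olh = sqrt_b_olh ^ 2"
| "coeff_b Nl = sqrt_b_bp * sqrt_b_olh"

text \<open>\<open>U\<close> is a function from coloured ribbon graphs to \<open>U_ring\<close> that obeys the recursion.\<close>

definition U_recursion :: "('p coloured_ribbon_graph \<Rightarrow> upoly) \<Rightarrow> bool" where
  "U_recursion U \<longleftrightarrow>
     (\<forall>G. coloured_ribbon_graph G \<longrightarrow> U G \<in> U_ring) \<and>
     (\<forall>G e i j. coloured_ribbon_graph G \<and> edge_type G e i j \<longrightarrow>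
        U G = coeff_a i * U (delete G e) + coeff_b j * U (contract G e)) \<and>
     (\<forall>G. coloured_ribbon_graph G \<and> edges G = {} \<longrightarrow>
        U G = alpha ^ card (vclasses G) * beta ^ card (bclasses G) * gamma ^ card (verts G))"

text \<open>\<open>half_pow s q\<close> is the power of \<open>s\<^sup>2\<close> to the exponent \<open>q\<close>, for \<open>q\<close> an integer multiple of \<open>1/2\<close>.\<close>

definition half_pow :: "'k::field \<Rightarrow> rat \<Rightarrow> 'k" where
  "half_pow s q = s powi \<lfloor>2 * q\<rfloor>"

abbreviation fr :: "upoly \<Rightarrow> upoly fract" where
  "fr \<equiv> to_fract"

end

theory Submission
  imports Defs
begin

text \<open>
  Every term of the state sum is a monomial whose exponents are determined by three counts: the
  components of \<open>(G/V, A)\<close>, the components of \<open>(G\<^sup>*/B, E - A)\<close> and the boundary components of \<open>(V, A)\<close>.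
  Deleting \<open>e\<close> leaves the three counts at \<open>A\<close> unchanged, and the counts at \<open>A\<close> after contracting
  \<open>e\<close> are those at \<open>A \<union> {e}\<close> before, because both operations just merge all colour classes that
  meet \<open>e\<close>. So the terms without and with \<open>e\<close> give the two summands of the recursion, provided
  the type of an edge is the change of the four ranks when it is added, which has to be checked
  only for ribbon graphs with one edge. The same fact, applied to one-edge minors, shows that the
  ranks are monotone, hence that the state sum is a polynomial.

  For one edge, cut its two slots out of the boundaries of the vertices. The remaining arcs and
  slots join the four points of the edge in pairs, in one of three ways, which are the
  non-loops, the orientable loops and the non-orientable loops.
\<close>

section \<open>Connected components\<close>

text \<open>The recursion may be applied to any edge and its type is read off from minors taken in
  some order, so it is not evident that a function \<open>U\<close> exists. Hence nothing is defined
  by recursion: \<open>state_sum\<close> is given in closed form and satisfies the recursion at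
  every edge, and since every edge has some type, induction on the number of edges leaves no other
  function. Types are compared only through differences of the three counts, so the order of the
  operations never enters. That the four points of an edge are joined in pairs is obtained without
  tracing paths. Arcs and slots alternate along vertex circles, so the points have an alternating
  two-colouring. After the two slots of the edge are cut out, every class still contains equally
  many points of the edge of either colour, and a class with all four would have too few arcs and
  slots to be connected. The same colouring, read as an orientation, decides whether a loop is
  orientable. Non-orientable loops give half-integral ranks, so \<open>r2\<close> and
  \<open>r4\<close> are doubled throughout and the square roots serve as generators.\<close>

definition conn :: "('w \<times> 'w) set \<Rightarrow> ('w \<times> 'w) set" where
  "conn R = (R \<union> R\<inverse>)\<^sup>*"

abbreviation num_classes :: "'w set \<Rightarrow> ('w \<times> 'w) set \<Rightarrow> nat" where
  "num_classes W R \<equiv> card (components W R)"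

lemma conn_refl [simp]: "(x, x) \<in> conn R"
  by (simp add: conn_def)

lemma conn_sym: "(x, y) \<in> conn R \<Longrightarrow> (y, x) \<in> conn R"
  unfolding conn_def by (meson symD sym_Un_converse sym_rtrancl)

lemma conn_trans: "(x, y) \<in> conn R \<Longrightarrow> (y, z) \<in> conn R \<Longrightarrow> (x, z) \<in> conn R"
  unfolding conn_def by (rule rtrancl_trans)

lemma conn_incl: "(x, y) \<in> R \<Longrightarrow> (x, y) \<in> conn R"
  by (auto simp: conn_def)

lemma conn_minimal:
  assumes "R \<subseteq> conn S" shows "conn R \<subseteq> conn S"
proof -
  have "R \<union> R\<inverse> \<subseteq> conn S" using assms by (auto intro: conn_sym)
  then have "(R \<union> R\<inverse>)\<^sup>* \<subseteq> (conn S)\<^sup>*" by (rule rtrancl_mono)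
  then show ?thesis by (simp add: conn_def)
qed

lemma conn_mono: "R \<subseteq> S \<Longrightarrow> conn R \<subseteq> conn S"
  by (rule conn_minimal) (auto intro: conn_incl)

lemma conn_invariant:
  assumes "(x, y) \<in> conn R" "P x" "\<And>u v. (u, v) \<in> R \<Longrightarrow> P u \<longleftrightarrow> P v"
  shows "P y"
  using assms(1) unfolding conn_def
  by (induction rule: rtrancl_induct) (use assms(2,3) in auto)

lemma components_alt: "components W R = (\<lambda>x. {y \<in> W. (x, y) \<in> conn R}) ` W"
  unfolding components_def conn_def quotient_def by auto

lemma finite_components [simp]: "finite W \<Longrightarrow> finite (components W R)"
  by (simp add: components_alt)

lemma partition_components: "partition_on W (components W R)"
proof -
  have "equiv W {(x, y). x \<in> W \<and> y \<in> W \<and> (x, y) \<in> conn R}"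
    by (intro equivI refl_onI symI transI) (auto intro: conn_sym conn_trans)
  then show ?thesis unfolding components_def conn_def by (rule partition_on_quotient)
qed

lemma components_cong:
  assumes "\<And>x y. x \<in> W \<Longrightarrow> y \<in> W \<Longrightarrow> (x, y) \<in> conn R \<longleftrightarrow> (x, y) \<in> conn S"
  shows "components W R = components W S"
  unfolding components_alt by (rule image_cong) (use assms in auto)

lemma components_eqI:
  assumes "R \<subseteq> conn S" "S \<subseteq> conn R"
  shows "components W R = components W S"
  by (rule components_cong) (use conn_minimal[OF assms(1)] conn_minimal[OF assms(2)] in blast)

lemma component_eq_iff:
  assumes "x \<in> W" "y \<in> W"
  shows "{u \<in> W. (x, u) \<in> conn R} = {u \<in> W. (y, u) \<in> conn R} \<longleftrightarrow> (x, y) \<in> conn R"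
  using assms by (auto intro: conn_trans conn_sym)

text \<open>A surjection that preserves and reflects connectedness maps classes onto classes, and
  distinct classes to distinct ones.\<close>

lemma num_classes_transfer:
  assumes f: "f ` W = Z"
    and iff: "\<And>x y. x \<in> W \<Longrightarrow> y \<in> W \<Longrightarrow> (x, y) \<in> conn R \<longleftrightarrow> (f x, f y) \<in> conn S"
  shows "num_classes W R = num_classes Z S"
proof (rule bij_betw_same_card)
  have img: "f ` {y \<in> W. (x, y) \<in> conn R} = {z \<in> Z. (f x, z) \<in> conn S}" if "x \<in> W" for x
    using that f iff by auto
  have "inj_on (image f) (components W R)"
  proof (rule inj_onI)
    fix A B assume A: "A \<in> components W R" and B: "B \<in> components W R" and eq: "f ` A = f ` B"
    obtain x where x: "x \<in> W" "A = {y \<in> W. (x, y) \<in> conn R}" using A by (auto simp: components_alt)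
    obtain y where y: "y \<in> W" "B = {u \<in> W. (y, u) \<in> conn R}" using B by (auto simp: components_alt)
    have "(f x, f y) \<in> conn S"
      using eq x y img[of x] img[of y] f component_eq_iff[of "f x" Z "f y" S] by auto
    then show "A = B" using iff x y component_eq_iff[of x W y R] by auto
  qed
  moreover have "image f ` components W R = components Z S"
    using img f unfolding components_alt by (force simp: image_image)
  ultimately show "bij_betw (image f) (components W R) (components Z S)"
    by (simp add: bij_betw_def)
qed

text \<open>A path can be shortened until it uses the new pair at most once, in one of two
  directions. In the proof the right-hand side, as a property of \<open>v\<close>, is invariant
  along every old pair and along the new one.\<close>

lemma conn_insert_iff:
  "(u, v) \<in> conn (insert (x, y) R) \<longleftrightarrow> (u, v) \<in> conn R
     \<or> (u, x) \<in> conn R \<and> (y, v) \<in> conn R \<or> (u, y) \<in> conn R \<and> (x, v) \<in> conn R"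
    (is "_ \<longleftrightarrow> ?Q u v")
proof
  assume "(u, v) \<in> conn (insert (x, y) R)"
  then show "?Q u v"
  proof (rule conn_invariant)
    fix s t assume "(s, t) \<in> insert (x, y) R"
    then consider "s = x" "t = y" | "(s, t) \<in> conn R" by (auto intro: conn_incl)
    then show "?Q u s \<longleftrightarrow> ?Q u t"
    proof cases
      case 1 then show ?thesis by (auto intro: conn_trans conn_sym)
    next
      case 2
      then have "(w, s) \<in> conn R \<longleftrightarrow> (w, t) \<in> conn R" for w by (blast intro: conn_trans conn_sym)
      then show ?thesis by simp
    qed
  qed auto
next
  have "conn R \<subseteq> conn (insert (x, y) R)" by (rule conn_mono) auto
  moreover have "(x, y) \<in> conn (insert (x, y) R)" by (simp add: conn_incl)
  ultimately show "?Q u v \<Longrightarrow> (u, v) \<in> conn (insert (x, y) R)"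
    by (meson conn_sym conn_trans subsetD)
qed

lemma num_classes_insert_conn:
  assumes "(x, y) \<in> conn R"
  shows "num_classes W (insert (x, y) R) = num_classes W R"
  by (rule arg_cong[where f = card], rule components_eqI) (use assms in \<open>auto intro: conn_incl\<close>)

lemma num_classes_insert_not_conn:
  assumes "finite W" "x \<in> W" "y \<in> W" "(x, y) \<notin> conn R"
  shows "num_classes W R = Suc (num_classes W (insert (x, y) R))"
proof -
  define cl where "cl u = {v \<in> W. (u, v) \<in> conn R}" for u
  define cl' where "cl' u = {v \<in> W. (u, v) \<in> conn (insert (x, y) R)}" for u
  have cl': "cl' u = (if u \<in> cl x \<union> cl y then cl x \<union> cl y else cl u)" if "u \<in> W" for u
    using that assms unfolding cl_def cl'_def conn_insert_iff
    by (auto intro: conn_trans conn_sym)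
  have cl_in: "u \<in> cl u" if "u \<in> W" for u using that by (simp add: cl_def)
  have cl_eq: "u \<in> cl x \<longleftrightarrow> cl u = cl x" "u \<in> cl y \<longleftrightarrow> cl u = cl y" if "u \<in> W" for u
    using that assms unfolding cl_def by (auto intro: conn_trans conn_sym)
  have comps: "components W R = cl ` W" "components W (insert (x, y) R) = cl' ` W"
    by (simp_all add: components_alt cl_def cl'_def)
  have "cl' ` W = insert (cl x \<union> cl y) (cl ` W - {cl x, cl y})"
  proof (intro equalityI subsetI)
    fix C assume "C \<in> cl' ` W"
    then obtain u where "u \<in> W" "C = cl' u" by auto
    then show "C \<in> insert (cl x \<union> cl y) (cl ` W - {cl x, cl y})"
      using cl' cl_eq by auto
  next
    fix C assume "C \<in> insert (cl x \<union> cl y) (cl ` W - {cl x, cl y})"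
    then consider "C = cl x \<union> cl y" | u where "u \<in> W" "C = cl u" "C \<noteq> cl x" "C \<noteq> cl y" by auto
    then show "C \<in> cl' ` W"
    proof cases
      case 1
      then show ?thesis using cl'[of x] cl_in[of x] assms(2) by (intro image_eqI[of _ _ x]) auto
    next
      case 2
      then show ?thesis using cl'[of u] cl_eq[of u] by (intro image_eqI[of _ _ u]) auto
    qed
  qed
  \<comment> \<open>The fused class is new among the remaining ones, so two classes are lost and one
    is gained.\<close>
  moreover have "cl x \<union> cl y \<notin> cl ` W - {cl x, cl y}"
  proof
    assume "cl x \<union> cl y \<in> cl ` W - {cl x, cl y}"
    then obtain u where u: "u \<in> W" "cl x \<union> cl y = cl u" "cl u \<noteq> cl x" by auto
    then have "x \<in> cl u" using cl_in assms by blast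
    then have "cl u = cl x" using u assms by (auto simp: cl_def intro: conn_trans conn_sym)
    then show False using u by simp
  qed
  moreover have "cl x \<noteq> cl y" using assms cl_in cl_eq by (metis (no_types, lifting) cl_def mem_Collect_eq)
  \<comment> \<open>The cardinality of the difference is a truncated subtraction; this bound makes
    it exact.\<close>
  moreover have "card (cl ` W) \<ge> card {cl x, cl y}" using assms by (intro card_mono) auto
  ultimately show ?thesis using assms unfolding comps
    by (simp add: card_Diff_subset)
qed

section \<open>Bounds for the number of classes, and alternating colourings\<close>

lemma num_classes_empty: "num_classes W {} = card W"
proof -
  have "components W {} = (\<lambda>x. {x}) ` W" by (auto simp: components_alt conn_def)
  then show ?thesis by (simp add: card_image)
qed

text \<open>Each further pair fuses at most two classes, starting from singletons. With a single
  class this is the fact that a connected graph on n points has at least n - 1 edges.\<close>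

lemma card_le_num_classes_plus_card:
  assumes "finite S" "finite W" "S \<subseteq> W \<times> W"
  shows "card W \<le> num_classes W S + card S"
  using assms
proof (induction S)
  case empty
  then show ?case by (simp add: num_classes_empty)
next
  case (insert p S)
  obtain x y where p: "p = (x, y)" by force
  show ?case
  proof (cases "(x, y) \<in> conn S")
    case True
    then show ?thesis using insert p num_classes_insert_conn[of x y S W] by simp
  next
    case False
    then show ?thesis using insert p num_classes_insert_not_conn[of W x y S] by simp
  qed
qed

text \<open>The orbits of two involutions without fixed points are cycles of even length. The
  induction removes \<open>x\<close> and \<open>a x\<close> and repairs \<open>b\<close>, so
  \<open>b\<close> varies while \<open>a\<close> stays fixed.\<close>

lemma two_colouring:
  assumes "finite W"
    and "\<And>u. u \<in> W \<Longrightarrow> a u \<in> W \<and> a u \<noteq> u \<and> a (a u) = u"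
    and "\<And>u. u \<in> W \<Longrightarrow> b u \<in> W \<and> b u \<noteq> u \<and> b (b u) = u"
  shows "\<exists>s :: 'w \<Rightarrow> bool. \<forall>u\<in>W. s (a u) \<noteq> s u \<and> s (b u) \<noteq> s u"
  using assms
proof (induction "card W" arbitrary: W b rule: less_induct)
  case less
  show ?case
  proof (cases "W = {}")
    case False
    then obtain x where x: "x \<in> W" by auto
    define y where "y = a x"
    define W' where "W' = W - {x, y}"
    have y: "y \<in> W" "y \<noteq> x" "a y = x" using less(3)[OF x] by (auto simp: y_def)
    have fin: "finite W'" "card W' < card W"
      using less(2) x by (auto simp: W'_def intro!: psubset_card_mono)
    have aW': "a u \<in> W' \<and> a u \<noteq> u \<and> a (a u) = u" if "u \<in> W'" for u
      using that less(3)[of u] y by (auto simp: W'_def y_def)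
    show ?thesis
    proof (cases "b x = y")
      case True
      then have by': "b y = x" using less(4)[OF x] by auto
      have "b u \<in> W' \<and> b u \<noteq> u \<and> b (b u) = u" if "u \<in> W'" for u
        using that less(4)[of u] True by' by (auto simp: W'_def)
      then obtain s where s: "\<forall>u\<in>W'. s (a u) \<noteq> s u \<and> s (b u) \<noteq> (s u :: bool)"
        using less(1)[OF fin(2) fin(1) aW', of b] by blast
      let ?s = "s(x := True, y := False)"
      have "\<forall>u\<in>W. ?s (a u) \<noteq> ?s u \<and> ?s (b u) \<noteq> ?s u"
      proof
        fix u assume u: "u \<in> W"
        show "?s (a u) \<noteq> ?s u \<and> ?s (b u) \<noteq> ?s u"
        proof (cases "u \<in> W'")
          case u': True
          then have "b u \<noteq> x" "b u \<noteq> y" "a u \<noteq> x" "a u \<noteq> y"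
            using less(4)[OF u] aW'[OF u'] True by' by (auto simp: W'_def)
          then show ?thesis using s u' by (auto simp: W'_def)
        next
          case False
          then have "u = x \<or> u = y" using u by (auto simp: W'_def)
          then show ?thesis using True by' y by (auto simp: y_def)
        qed
      qed
      then show ?thesis by blast
    next
      case False
      define u w where "u = b x" and "w = b y"
      have uw: "u \<in> W'" "w \<in> W'" "u \<noteq> w" "b u = x" "b w = y"
        using less(4)[OF x] less(4)[OF y(1)] False y x by (auto simp: u_def w_def W'_def)
      \<comment> \<open>The cycle is short-circuited: the \<open>b\<close>-partners of the two
        removed points become partners of each other.\<close>
      define b' where "b' = b(u := w, w := u)"
      have "b' z \<in> W' \<and> b' z \<noteq> z \<and> b' (b' z) = z" if z: "z \<in> W'" for z
      proof (cases "z = u \<or> z = w")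
        case True
        then show ?thesis using uw by (auto simp: b'_def)
      next
        case False
        have "b z \<noteq> x" "b z \<noteq> y" "b z \<noteq> u" "b z \<noteq> w"
          using False z less(4)[of z] uw by (auto simp: W'_def u_def w_def)
        then show ?thesis using False z less(4)[of z] by (auto simp: b'_def W'_def)
      qed
      then obtain s where s: "\<forall>u\<in>W'. s (a u) \<noteq> s u \<and> s (b' u) \<noteq> (s u :: bool)"
        using less(1)[OF fin(2) fin(1) aW', of b'] by blast
      have "s (b' u) \<noteq> s u" using s uw by blast
      then have suw: "s u \<noteq> s w" using uw by (auto simp: b'_def)
      have ne: "u \<noteq> x" "u \<noteq> y" "w \<noteq> x" "w \<noteq> y" using uw(1,2) by (simp_all add: W'_def)
      \<comment> \<open>Each removed point gets the colour opposite to its \<open>b\<close>-partner.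
        As \<open>b'\<close> forces \<open>u\<close> and \<open>w\<close> to differ,
        \<open>x\<close> and \<open>y\<close> differ too, as the pair of \<open>a\<close>
        requires.\<close>
      let ?s = "s(x := \<not> s u, y := \<not> s w)"
      have "\<forall>z\<in>W. ?s (a z) \<noteq> ?s z \<and> ?s (b z) \<noteq> ?s z"
      proof
        fix z assume z: "z \<in> W"
        consider "z = x" | "z = y" | "z = u" | "z = w" | "z \<in> W'" "z \<noteq> u" "z \<noteq> w"
          using z by (auto simp: W'_def)
        then show "?s (a z) \<noteq> ?s z \<and> ?s (b z) \<noteq> ?s z"
        proof cases
          case 1
          have "a x = y" "b x = u" by (simp_all add: y_def u_def)
          then show ?thesis unfolding 1 using suw y(2) ne by simp
        next
          case 2
          have "b y = w" by (simp add: w_def)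
          then show ?thesis unfolding 2 using suw y(2,3) ne by simp
        next
          case 3
          have "a u \<notin> {x, y}" "s (a u) \<noteq> s u" using s uw aW'[of u] by (auto simp: W'_def)
          then show ?thesis unfolding 3 uw(4) using y(2) ne by simp
        next
          case 4
          have "a w \<notin> {x, y}" "s (a w) \<noteq> s w" using s uw aW'[of w] by (auto simp: W'_def)
          then show ?thesis unfolding 4 uw(5) using y(2) ne by simp
        next
          case 5
          have "b z \<noteq> x" "b z \<noteq> y" using 5 less(4)[OF z] unfolding u_def w_def by metis+
          moreover have "b' z = b z" using 5 by (simp add: b'_def)
          then have "s (b z) \<noteq> s z" using s 5(1) by metis
          moreover have "a z \<notin> {x, y}" "s (a z) \<noteq> s z" using s 5 aW'[of z] by (auto simp: W'_def)
          ultimately show ?thesis using 5 by (auto simp: W'_def)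
        qed
      qed
      then show ?thesis by blast
    qed
  qed auto
qed

lemma balanced_of_flip:
  assumes "\<And>u. u \<in> S \<Longrightarrow> t u \<in> S \<and> t (t u) = u \<and> s (t u) \<noteq> (s u :: bool)"
  shows "card {u \<in> S. s u} = card {u \<in> S. \<not> s u}"
  by (rule bij_betw_same_card[of t], rule bij_betwI[of _ _ _ t]) (use assms in auto)

section \<open>Colour classes\<close>

text \<open>
  Colour classes are turned into relations on points: these can be compared before and after
  deletion and contraction, which change vertices and boundary components but not the set of points.
\<close>

definition block_rel :: "'p set set set \<Rightarrow> ('p \<times> 'p) set" where
  "block_rel P = (\<Union>C\<in>P. \<Union>C \<times> \<Union>C)"

lemma block_unique:
  assumes V: "partition_on W V" and P: "partition_on V P"
    and CD: "C \<in> P" "D \<in> P" "x \<in> \<Union>C" "x \<in> \<Union>D"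
  shows "C = D"
proof -
  obtain v w where vw: "v \<in> C" "x \<in> v" "w \<in> D" "x \<in> w" using CD by (meson UnionE)
  then have "v \<in> V" "w \<in> V" using CD P by (auto simp: partition_on_def)
  then have "v = w" using vw V unfolding partition_on_def disjoint_def by blast
  then show ?thesis using vw CD P unfolding partition_on_def disjoint_def by blast
qed

text \<open>The map \<open>f\<close> from a point to its colour class collapses every block to a
  vertex of the quotient graph, and two points of one edge go to ends of that edge. This turns the
  components of the quotient graphs into classes of points.\<close>

lemma num_classes_quotient:
  fixes W :: "'p set"
  assumes V: "partition_on W V" and P: "partition_on V P" and A: "\<And>a. a \<in> A \<Longrightarrow> a \<subseteq> W"
  shows "num_classes P {(C, D). \<exists>a\<in>A. C \<in> {C \<in> P. C \<inter> {v \<in> V. v \<inter> a \<noteq> {}} \<noteq> {}}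
            \<and> D \<in> {C \<in> P. C \<inter> {v \<in> V. v \<inter> a \<noteq> {}} \<noteq> {}}}
       = num_classes W (block_rel P \<union> (\<Union>a\<in>A. a \<times> a))"
    (is "num_classes P ?S = num_classes W ?R")
proof -
  have UV: "\<Union>V = W" and UP: "\<Union>P = V" using V P by (auto simp: partition_on_def)
  have "\<forall>x\<in>W. \<exists>C. C \<in> P \<and> x \<in> \<Union>C" using UV UP by blast
  then obtain f where f: "\<And>x. x \<in> W \<Longrightarrow> f x \<in> P" "\<And>x. x \<in> W \<Longrightarrow> x \<in> \<Union>(f x)" by metis
  note uniq = block_unique[OF V P]
  have feq: "f x = C" if "C \<in> P" "x \<in> \<Union>C" for x C
  proof -
    have "x \<in> W" using that UP UV by blast
    then show ?thesis using uniq[of "f x" C x] that f by blast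
  qed
  have img: "f ` W = P"
  proof (intro equalityI subsetI)
    fix C assume C: "C \<in> P"
    then have "C \<noteq> {}" using P by (auto simp: partition_on_def)
    then obtain v where v: "v \<in> C" by auto
    then have "v \<noteq> {}" "v \<in> V" using C UP V by (auto simp: partition_on_def)
    then obtain x where "x \<in> v" by auto
    then show "C \<in> f ` W" using v C feq[of C x] UV \<open>v \<in> V\<close> by blast
  qed (use f in auto)
  \<comment> \<open>Touching is expressed by points alone, which removes the intermediate vertices
    or boundary components from the relation.\<close>
  define t where "t C a \<longleftrightarrow> (\<exists>p\<in>a. p \<in> \<Union>C)" for C :: "'p set set" and a
  have mem: "C \<inter> {v \<in> V. v \<inter> a \<noteq> {}} \<noteq> {} \<longleftrightarrow> t C a" if "C \<in> P" for C a
    using that UP unfolding t_def by blast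
  have S: "(C, D) \<in> ?S \<longleftrightarrow> C \<in> P \<and> D \<in> P \<and> (\<exists>a\<in>A. t C a \<and> t D a)" for C D
  proof -
    have "(C, D) \<in> ?S \<longleftrightarrow> (\<exists>a\<in>A. (C \<in> P \<and> C \<inter> {v \<in> V. v \<inter> a \<noteq> {}} \<noteq> {})
        \<and> (D \<in> P \<and> D \<inter> {v \<in> V. v \<inter> a \<noteq> {}} \<noteq> {}))" by (simp only: mem_Collect_eq case_prod_conv)
    also have "\<dots> \<longleftrightarrow> (\<exists>a\<in>A. (C \<in> P \<and> t C a) \<and> (D \<in> P \<and> t D a))"
      by (simp only: mem cong: conj_cong)
    finally show ?thesis by blast
  qed
  have fwd: "(f x, f y) \<in> conn ?S" if "(x, y) \<in> conn ?R" for x y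
    using that
  proof (rule conn_invariant)
    fix u v assume "(u, v) \<in> ?R"
    then consider C where "C \<in> P" "u \<in> \<Union>C" "v \<in> \<Union>C" | a where "a \<in> A" "u \<in> a" "v \<in> a"
      by (auto simp: block_rel_def)
    then have "(f u, f v) \<in> conn ?S"
    proof cases
      case 1
      then show ?thesis using feq[of C u] feq[of C v] by simp
    next
      case 2
      then have "u \<in> W" "v \<in> W" using A by blast+
      then have "t (f u) a" "t (f v) a" unfolding t_def using 2 f(2) by blast+
      then have "(f u, f v) \<in> ?S" unfolding S using 2 f \<open>u \<in> W\<close> \<open>v \<in> W\<close> by blast
      then show ?thesis by (rule conn_incl)
    qed
    then show "((f x, f u) \<in> conn ?S) = ((f x, f v) \<in> conn ?S)"
      by (blast intro: conn_trans conn_sym)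
  qed simp
  have block: "(p, q) \<in> conn ?R" if "C \<in> P" "p \<in> \<Union>C" "q \<in> \<Union>C" for C p q
    by (rule conn_incl) (use that in \<open>auto simp: block_rel_def\<close>)
  have step: "\<forall>y\<in>W. f y = D \<longrightarrow> (x, y) \<in> conn ?R"
    if CD: "(C, D) \<in> ?S" and IH: "\<forall>y\<in>W. f y = C \<longrightarrow> (x, y) \<in> conn ?R" for C D x
  proof (intro ballI impI)
    fix y assume y: "y \<in> W" "f y = D"
    obtain a p q where a: "a \<in> A" "p \<in> a" "q \<in> a" "p \<in> \<Union>C" "q \<in> \<Union>D" "C \<in> P" "D \<in> P"
      using CD unfolding S t_def by blast
    have "p \<in> W" using a A by auto
    then have "(x, p) \<in> conn ?R" using IH feq[of C p] a by auto
    moreover have "(p, q) \<in> conn ?R" by (rule conn_incl) (use a in auto)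
    moreover have "(q, y) \<in> conn ?R" using block[of D q y] a y f by auto
    ultimately show "(x, y) \<in> conn ?R" by (blast intro: conn_trans)
  qed
  have bwd: "(x, y) \<in> conn ?R" if "(f x, f y) \<in> conn ?S" "x \<in> W" "y \<in> W" for x y
  proof -
    \<comment> \<open>A path of colour classes does not single out points, so the invariant speaks
      of all points of the class reached.\<close>
    have "\<forall>y'\<in>W. f y' = f y \<longrightarrow> (x, y') \<in> conn ?R"
      using that(1)
    proof (rule conn_invariant)
      show "\<forall>y'\<in>W. f y' = f x \<longrightarrow> (x, y') \<in> conn ?R"
      proof (intro ballI impI)
        fix y' assume y': "y' \<in> W" "f y' = f x"
        have "x \<in> \<Union>(f x)" "y' \<in> \<Union>(f x)" "f x \<in> P" using f[OF that(2)] f[OF y'(1)] y'(2) by auto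
        then show "(x, y') \<in> conn ?R" using block by blast
      qed
    next
      fix C D assume CD: "(C, D) \<in> ?S"
      then have "(D, C) \<in> ?S" unfolding S by blast
      then show "(\<forall>y\<in>W. f y = C \<longrightarrow> (x, y) \<in> conn ?R) = (\<forall>y\<in>W. f y = D \<longrightarrow> (x, y) \<in> conn ?R)"
        using step[OF CD] step[of D C] by blast
    qed
    then show ?thesis using that(3) by auto
  qed
  show ?thesis
    by (rule num_classes_transfer[OF img, symmetric]) (use fwd bwd in blast)
qed

text \<open>As \<open>new\<close> covers the same points as \<open>old\<close>, replacing merges
  exactly the colour classes that meet \<open>e\<close> and keeps their point set. Joining all
  points of \<open>e\<close> to each other has the same effect.\<close>

lemma components_block_rel_replace_in:
  assumes P: "partition_on V P" and UV: "\<Union>V = W" and "e \<subseteq> W"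
    and old: "old = {v \<in> V. v \<inter> e \<noteq> {}}" and new: "\<Union>new = \<Union>old"
  shows "components W (block_rel (replace_in P old new) \<union> S) = components W (block_rel P \<union> e \<times> e \<union> S)"
proof (rule components_eqI)
  define M where "M = \<Union>{C \<in> P. C \<inter> old \<noteq> {}}"
  have UP: "\<Union>P = V" using P by (auto simp: partition_on_def)
  have "old \<subseteq> M" using UP old by (auto simp: M_def)
  then have UM: "\<Union>(M - old \<union> new) = \<Union>M" using new by blast
  have eM: "e \<subseteq> \<Union>M" using \<open>old \<subseteq> M\<close> \<open>e \<subseteq> W\<close> UV old by blast
  have rel: "block_rel (replace_in P old new) = \<Union>M \<times> \<Union>M \<union> block_rel {C \<in> P. C \<inter> old = {}}"
    unfolding block_rel_def replace_in_def using UM by (simp add: M_def)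
  have "block_rel P \<subseteq> block_rel (replace_in P old new)"
  proof (rule subrelI)
    fix p q assume "(p, q) \<in> block_rel P"
    then obtain C where C: "C \<in> P" "p \<in> \<Union>C" "q \<in> \<Union>C" by (auto simp: block_rel_def)
    show "(p, q) \<in> block_rel (replace_in P old new)"
    proof (cases "C \<inter> old = {}")
      case True
      then have "(p, q) \<in> block_rel {C \<in> P. C \<inter> old = {}}" unfolding block_rel_def using C by blast
      then show ?thesis unfolding rel by blast
    next
      case False
      then have "C \<subseteq> M" using C by (auto simp: M_def)
      then show ?thesis unfolding rel using C by auto
    qed
  qed
  then have "block_rel P \<union> e \<times> e \<union> S \<subseteq> block_rel (replace_in P old new) \<union> S"
    using eM unfolding rel by blast
  then show "block_rel P \<union> e \<times> e \<union> S \<subseteq> conn (block_rel (replace_in P old new) \<union> S)"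
    by (rule order_trans) (auto intro: conn_incl)
  \<comment> \<open>A class that is merged contains an element of \<open>old\<close>, hence a point
    of \<open>e\<close>, to which all its points are block-related.\<close>
  have *: "\<exists>p\<in>e. (x, p) \<in> conn (block_rel P \<union> e \<times> e \<union> S)" if x: "x \<in> \<Union>M" for x
  proof -
    obtain C v where "C \<in> P" "x \<in> \<Union>C" "v \<in> C" "v \<in> old" using x unfolding M_def by blast
    moreover then obtain p where "p \<in> v" "p \<in> e" using old by auto
    ultimately have "(x, p) \<in> block_rel P" by (auto simp: block_rel_def)
    then show ?thesis using \<open>p \<in> e\<close> by (auto intro: conn_incl)
  qed
  have "(x, y) \<in> conn (block_rel P \<union> e \<times> e \<union> S)" if xy: "x \<in> \<Union>M" "y \<in> \<Union>M" for x y
  proof -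
    obtain p q where "p \<in> e" "q \<in> e" "(x, p) \<in> conn (block_rel P \<union> e \<times> e \<union> S)"
      "(y, q) \<in> conn (block_rel P \<union> e \<times> e \<union> S)" using *[OF xy(1)] *[OF xy(2)] by blast
    moreover then have "(p, q) \<in> conn (block_rel P \<union> e \<times> e \<union> S)" by (intro conn_incl) auto
    ultimately show ?thesis by (meson conn_sym conn_trans)
  qed
  moreover have "block_rel {C \<in> P. C \<inter> old = {}} \<union> S \<subseteq> conn (block_rel P \<union> e \<times> e \<union> S)"
    by (auto intro!: conn_incl simp: block_rel_def)
  ultimately show "block_rel (replace_in P old new) \<union> S \<subseteq> conn (block_rel P \<union> e \<times> e \<union> S)"
    unfolding rel by auto
qed

section \<open>Recolouring after a change confined to one edge\<close>

lemma partition_on_replace_in: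
  assumes P: "partition_on V P" and "old \<subseteq> V" "new \<noteq> {}" "new \<inter> (V - old) = {}"
  shows "partition_on (V - old \<union> new) (replace_in P old new)"
proof -
  have UP: "\<Union>P = V" and ne: "{} \<notin> P" and dis: "\<And>C D. C \<in> P \<Longrightarrow> D \<in> P \<Longrightarrow> C \<noteq> D \<Longrightarrow> C \<inter> D = {}"
    using P by (auto simp: partition_on_def disjoint_def)
  define N where "N = \<Union>{C \<in> P. C \<inter> old \<noteq> {}} - old \<union> new"
  have N: "N \<inter> D = {}" if D: "D \<in> P" "D \<inter> old = {}" for D
  proof -
    have "D \<subseteq> V - old" using D UP by auto
    then have "new \<inter> D = {}" using assms(4) by auto
    moreover have "C \<inter> D = {}" if "C \<in> P" "C \<inter> old \<noteq> {}" for C using dis[of C D] that D by auto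
    ultimately show ?thesis unfolding N_def by auto
  qed
  have "disjoint (replace_in P old new)"
    unfolding disjoint_def replace_in_def N_def[symmetric]
  proof (intro ballI impI)
    fix C D assume "C \<in> insert N {C \<in> P. C \<inter> old = {}}" "D \<in> insert N {C \<in> P. C \<inter> old = {}}" "C \<noteq> D"
    then show "C \<inter> D = {}" using N[of C] N[of D] dis[of C D] by (elim insertE) (simp_all add: Int_commute)
  qed
  moreover have "\<Union>(replace_in P old new) = V - old \<union> new"
    unfolding replace_in_def using UP by auto
  moreover have "{} \<notin> replace_in P old new"
    unfolding replace_in_def using ne assms(3) by auto
  ultimately show ?thesis by (simp add: partition_on_def)
qed

text \<open>A class that avoids \<open>e\<close> never uses a pair on which the two relations
  differ.\<close>

lemma component_avoiding:
  assumes R: "R \<subseteq> W \<times> W" and R': "R' \<subseteq> W \<times> W" and eq: "R - e \<times> e = R' - e \<times> e"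
    and C: "C \<in> components W R" "C \<inter> e = {}"
  shows "C \<in> components W R'"
proof -
  obtain x where x: "x \<in> W" "C = {y \<in> W. (x, y) \<in> conn R}" using C by (auto simp: components_alt)
  \<comment> \<open>Both connections are carried along together: while following a pair of
    \<open>R'\<close>, only the connection by \<open>R\<close> shows that \<open>e\<close> has not
    been entered.\<close>
  let ?P = "\<lambda>u. (x, u) \<in> conn R \<and> (x, u) \<in> conn R'"
  have step: "?P u \<longleftrightarrow> ?P v" if "(u, v) \<in> R \<union> R'" for u v
  proof -
    have uv: "u \<in> W" "v \<in> W" using that R R' by auto
    have "(u, v) \<in> conn R \<and> (u, v) \<in> conn R'" if "(x, u) \<in> conn R \<or> (x, v) \<in> conn R"
    proof -
      have "u \<notin> e \<or> v \<notin> e" using that uv x C by auto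
      then have "(u, v) \<in> R" "(u, v) \<in> R'" using \<open>(u, v) \<in> R \<union> R'\<close> eq by auto
      then show ?thesis by (auto intro: conn_incl)
    qed
    then show ?thesis by (blast intro: conn_trans conn_sym)
  qed
  have "(x, y) \<in> conn R \<longleftrightarrow> (x, y) \<in> conn R'" for y
  proof
    assume "(x, y) \<in> conn R"
    then have "?P y" by (rule conn_invariant) (use step in auto)
    then show "(x, y) \<in> conn R'" by simp
  next
    assume "(x, y) \<in> conn R'"
    then have "?P y" by (rule conn_invariant) (use step in auto)
    then show "(x, y) \<in> conn R" by simp
  qed
  then have "C = {y \<in> W. (x, y) \<in> conn R'}" using x by simp
  then show ?thesis using x by (simp add: components_alt)
qed

text \<open>Classes away from \<open>e\<close> are the same for both relations, so those meeting
  \<open>e\<close> cover the same points, namely the rest of \<open>W\<close>. Deletion uses this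
  for boundary components and contraction for vertices; \<open>S\<close> will hold the pairs of the
  other edges.\<close>

lemma recolouring:
  fixes R R' :: "('p \<times> 'p) set"
  assumes R: "R \<subseteq> W \<times> W" and R': "R' \<subseteq> W \<times> W" and eq: "R - e \<times> e = R' - e \<times> e"
    and e: "e \<subseteq> W" "e \<noteq> {}" and P: "partition_on (components W R) P"
  defines "old \<equiv> {v \<in> components W R. v \<inter> e \<noteq> {}}" and "new \<equiv> {v \<in> components W R'. v \<inter> e \<noteq> {}}"
  shows "partition_on (components W R') (replace_in P old new)"
    and "components W (block_rel (replace_in P old new) \<union> S) = components W (block_rel P \<union> e \<times> e \<union> S)"
proof -
  have pR: "partition_on W (components W R)" and pR': "partition_on W (components W R')"
    by (rule partition_components)+
  then have U: "\<Union>(components W R) = W" "\<Union>(components W R') = W" by (auto simp: partition_on_def)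
  have off: "components W R - old = components W R' - new"
    using component_avoiding[OF R R' eq] component_avoiding[OF R' R eq[symmetric]]
    unfolding old_def new_def by auto
  have un: "\<Union>X = W - \<Union>(components W Q - X)" if "X \<subseteq> components W Q" for X Q
  proof -
    have p: "partition_on W (components W Q)" by (rule partition_components)
    then have "\<Union>X \<inter> \<Union>(components W Q - X) = {}"
      using that unfolding partition_on_def disjoint_def by (auto, metis IntI empty_iff subsetD)
    moreover have "X \<union> (components W Q - X) = components W Q" using that by blast
    then have "\<Union>X \<union> \<Union>(components W Q - X) = W"
      using p unfolding partition_on_def by (metis Union_Un_distrib)
    ultimately show ?thesis by blast
  qed
  have "\<Union>new = W - \<Union>(components W R' - new)" "\<Union>old = W - \<Union>(components W R - old)"
    by (rule un; simp add: old_def new_def)+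
  then have "\<Union>new = \<Union>old" using off by simp
  then show "components W (block_rel (replace_in P old new) \<union> S) = components W (block_rel P \<union> e \<times> e \<union> S)"
    using components_block_rel_replace_in[OF P U(1) e(1)] by (simp add: old_def)
  obtain p where p: "p \<in> e" "p \<in> W" using e by blast
  then obtain v where "v \<in> components W R'" "p \<in> v" using U(2) by (metis UnionE)
  then have "v \<in> new" using p by (auto simp: new_def)
  then have new: "new \<noteq> {}" by auto
  have "old \<subseteq> components W R" "new \<inter> (components W R - old) = {}" using off by (auto simp: old_def)
  then have "partition_on (components W R - old \<union> new) (replace_in P old new)"
    using new by (intro partition_on_replace_in[OF P])
  moreover have "new \<subseteq> components W R'" by (simp add: new_def)
  then have "components W R - old \<union> new = components W R'" using off by blast
  ultimately show "partition_on (components W R') (replace_in P old new)" by simp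
qed

section \<open>The ways in which the points of an edge are joined\<close>

text \<open>
  In the applications \<open>a\<close> is \<open>arc\<close>, \<open>b\<close> is \<open>slot\<close>, and the sides of the edge join \<open>x\<close> to \<open>y\<close> and
  \<open>b x\<close> to \<open>b y\<close>.
\<close>

locale cut_slots =
  fixes W :: "'w set" and a b :: "'w \<Rightarrow> 'w" and x y :: 'w
  assumes fin: "finite W"
    and a: "\<And>u. u \<in> W \<Longrightarrow> a u \<in> W \<and> a u \<noteq> u \<and> a (a u) = u"
    and b: "\<And>u. u \<in> W \<Longrightarrow> b u \<in> W \<and> b u \<noteq> u \<and> b (b u) = u"
    and xy: "x \<in> W" "y \<in> W" "y \<noteq> x" "y \<noteq> b x"
begin

abbreviation e where "e \<equiv> {x, b x, y, b y}"

text \<open>As a graph this has one arc and one slot at each point outside \<open>e\<close>, but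
  only an arc at the points of \<open>e\<close>. It therefore consists of cycles avoiding
  \<open>e\<close> and of paths ending in \<open>e\<close>; the lemmas below extract the pairing of
  the four ends by counting.\<close>

definition cut :: "('w \<times> 'w) set" where
  "cut = {(u, a u) |u. u \<in> W} \<union> {(u, b u) |u. u \<in> W - e}"

lemma e_W: "e \<subseteq> W" using xy b[OF xy(1)] b[OF xy(2)] by simp

lemma distinct_e: "distinct [x, b x, y, b y]"
proof -
  have "b y \<noteq> x" "b x \<noteq> b y" using b[OF xy(1)] b[OF xy(2)] xy(3,4) by metis+
  then show ?thesis using b[OF xy(1)] b[OF xy(2)] xy(3,4) by auto
qed

lemma b_e: "u \<in> e \<Longrightarrow> b u \<in> e" using b[OF xy(1)] b[OF xy(2)] by auto

lemma b_off:
  assumes "u \<in> W - e" shows "b u \<in> W - e"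
proof -
  have "b u \<in> W" "b (b u) = u" using b[of u] assms by simp_all
  then show ?thesis using b_e[of "b u"] assms by (simp only: Diff_iff) blast
qed

definition cl where "cl p = {u \<in> W. (p, u) \<in> conn cut}"

lemma cl_closed:
  shows "u \<in> cl p \<Longrightarrow> a u \<in> cl p" and "u \<in> cl p - e \<Longrightarrow> b u \<in> cl p - e"
proof -
  assume "u \<in> cl p"
  moreover then have "(u, a u) \<in> conn cut" by (intro conn_incl) (auto simp: cl_def cut_def)
  ultimately show "a u \<in> cl p" using a[of u] by (auto simp: cl_def intro: conn_trans)
next
  assume u: "u \<in> cl p - e"
  then have "(u, b u) \<in> conn cut" by (intro conn_incl) (auto simp: cl_def cut_def)
  then have "b u \<in> cl p" using u b[of u] by (auto simp: cl_def intro: conn_trans)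
  then show "b u \<in> cl p - e" using u b_off[of u] by (auto simp: cl_def)
qed

text \<open>The involution \<open>a\<close> exchanges the colours on the class, \<open>b\<close>
  does so on the class without \<open>e\<close>, and subtracting leaves the points of
  \<open>e\<close> balanced. Alternation is assumed on one class only, so that an orientation of the
  ends of a loop can be used as \<open>s\<close>. The signed sum is convenient for deciding which of
  the four points lie in the class.\<close>

lemma balanced:
  assumes "\<And>u. u \<in> cl p \<Longrightarrow> s (a u) \<noteq> (s u :: bool) \<and> s (b u) \<noteq> s u"
  shows "card {u \<in> cl p. s u} = card {u \<in> cl p. \<not> s u}"
    and "card {u \<in> cl p - e. s u} = card {u \<in> cl p - e. \<not> s u}"
    and "(\<Sum>u\<in>e. if u \<in> cl p then if s u then 1 else - 1 else 0) = (0::int)"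
proof -
  have fin_cl: "finite (cl p)" using fin by (simp add: cl_def)
  show 1: "card {u \<in> cl p. s u} = card {u \<in> cl p. \<not> s u}"
  proof (rule balanced_of_flip)
    fix u assume u: "u \<in> cl p"
    then have "u \<in> W" by (simp add: cl_def)
    then show "a u \<in> cl p \<and> a (a u) = u \<and> s (a u) \<noteq> s u" using u cl_closed a assms by blast
  qed
  show 2: "card {u \<in> cl p - e. s u} = card {u \<in> cl p - e. \<not> s u}"
  proof (rule balanced_of_flip)
    fix u assume u: "u \<in> cl p - e"
    then have "u \<in> W" by (simp add: cl_def)
    then show "b u \<in> cl p - e \<and> b (b u) = u \<and> s (b u) \<noteq> s u" using u cl_closed b assms by blast
  qed
  have int: "card {u \<in> cl p. Q u} = card {u \<in> cl p - e. Q u} + card {u \<in> cl p \<inter> e. Q u}" for Q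
  proof -
    have "{u \<in> cl p. Q u} = {u \<in> cl p - e. Q u} \<union> {u \<in> cl p \<inter> e. Q u}" by blast
    moreover have "{u \<in> cl p - e. Q u} \<inter> {u \<in> cl p \<inter> e. Q u} = {}" by blast
    ultimately show ?thesis using fin_cl by (simp add: card_Un_disjoint)
  qed
  have 3: "card {u \<in> cl p \<inter> e. s u} = card {u \<in> cl p \<inter> e. \<not> s u}"
    using 1 2 int[of s] int[of "\<lambda>u. \<not> s u"] by linarith
  have "(\<Sum>u\<in>e. if u \<in> cl p then if s u then 1 else - 1 else 0) = (\<Sum>u\<in>cl p \<inter> e. if s u then 1 else - 1 :: int)"
    by (rule sum.mono_neutral_cong_right) auto
  also have "\<dots> = int (card {u \<in> cl p \<inter> e. s u}) - int (card {u \<in> cl p \<inter> e. \<not> s u})"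
  proof -
    have "{u \<in> cl p \<inter> e. s u} = cl p \<inter> e \<inter> Collect s" "{u \<in> cl p \<inter> e. \<not> s u} = cl p \<inter> e \<inter> - Collect s"
      by blast+
    then show ?thesis by (simp only: sum.If_cases finite_Int fin_cl simp_thms sum_constant)
  qed
  also have "\<dots> = 0" using 3 by (simp only: diff_self)
  finally show "(\<Sum>u\<in>e. if u \<in> cl p then if s u then 1 else - 1 else 0) = (0::int)" .
qed

lemma colouring:
  obtains s :: "'w \<Rightarrow> bool" where "\<And>u. u \<in> W \<Longrightarrow> s (a u) \<noteq> s u \<and> s (b u) \<noteq> s u"
  using two_colouring[OF fin a b] by blast

text \<open>A class containing all four points would be connected with two edges less than points.\<close>

lemma not_all_four: "\<not> e \<subseteq> cl p"
proof
  assume sub: "e \<subseteq> cl p"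
  obtain s :: "'w \<Rightarrow> bool" where s: "\<And>u. u \<in> W \<Longrightarrow> s (a u) \<noteq> s u \<and> s (b u) \<noteq> s u"
    using colouring by blast
  then have s': "s (a u) \<noteq> s u \<and> s (b u) \<noteq> s u" if "u \<in> cl p" for u using that by (auto simp: cl_def)
  have fin_cl: "finite (cl p)" using fin by (simp add: cl_def)
  \<comment> \<open>Each arc and each slot is listed once, starting at its end coloured
    \<open>True\<close>. With n points in the class this gives at most n/2 + (n - 4)/2 = n - 2
    pairs.\<close>
  define T where "T = (\<lambda>u. (u, a u)) ` {u \<in> cl p. s u} \<union> (\<lambda>u. (u, b u)) ` {u \<in> cl p - e. s u}"
  have split: "card A = card {u \<in> A. s u} + card {u \<in> A. \<not> s u}" if "finite A" for A
  proof -
    have "A = {u \<in> A. s u} \<union> {u \<in> A. \<not> s u}" "{u \<in> A. s u} \<inter> {u \<in> A. \<not> s u} = {}" by blast+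
    then show ?thesis using that by (metis (no_types, lifting) card_Un_disjoint finite_Un)
  qed
  have cards: "card (cl p) = 2 * card {u \<in> cl p. s u}" "card (cl p - e) = 2 * card {u \<in> cl p - e. s u}"
    using split[of "cl p"] split[of "cl p - e"] balanced(1,2)[of p s] s' fin_cl by simp_all
  have "card e = 4" using distinct_card[OF distinct_e] by simp
  then have "card (cl p - e) + 4 = card (cl p)"
    using sub fin_cl by (metis card_Diff_subset card_mono finite_subset le_add_diff_inverse2)
  moreover have "card T \<le> card {u \<in> cl p. s u} + card {u \<in> cl p - e. s u}"
    unfolding T_def using fin_cl by (intro order_trans[OF card_Un_le] add_mono card_image_le) auto
  ultimately have T: "card T + 2 \<le> card (cl p)" using cards by linarith
  have "T \<subseteq> cl p \<times> cl p" unfolding T_def using cl_closed by blast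
  moreover have "finite T" unfolding T_def using fin_cl by auto
  ultimately have le: "card (cl p) \<le> num_classes (cl p) T + card T"
    using card_le_num_classes_plus_card fin_cl by blast
  have conn_T: "(u, v) \<in> conn T" if cut: "(u, v) \<in> cut" "u \<in> cl p" for u v
  proof -
    have uv: "u \<in> W" "v \<in> cl p" using cut cl_closed by (auto simp: cut_def cl_def)
    have "v = a u \<or> v = b u \<and> u \<in> W - e" using cut(1) by (auto simp: cut_def)
    then consider "v = a u" | "v = b u" "u \<notin> e" "v \<notin> e" using b_off[of u] by (metis DiffD2)
    then have "(u, v) \<in> T \<or> (v, u) \<in> T"
    proof cases
      case 1
      then have "u = a v" "s u \<noteq> s v" using 1 a[OF uv(1)] s[OF uv(1)] by metis+
      then show ?thesis using 1 cut uv by (cases "s u") (auto simp: T_def)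
    next
      case 2
      then have "u = b v" "s u \<noteq> s v" using 2(1) b[OF uv(1)] s[OF uv(1)] by metis+
      then show ?thesis using 2 cut uv by (cases "s u") (auto simp: T_def)
    qed
    then show ?thesis by (auto intro: conn_incl conn_sym)
  qed
  have px: "x \<in> cl p" using sub by simp
  \<comment> \<open>\<open>T\<close> still connects the class, so the bound for a single class asks
    for at least n - 1 pairs.\<close>
  have all: "(x, u) \<in> conn T" if "u \<in> cl p" for u
  proof -
    have "(x, u) \<in> conn cut" using px that by (auto simp: cl_def intro: conn_trans conn_sym)
    then have "u \<in> cl p \<and> (x, u) \<in> conn T"
    proof (rule conn_invariant)
      fix u v assume uv: "(u, v) \<in> cut"
      then have W: "u \<in> W" "v \<in> W" using a b by (auto simp: cut_def)
      have "u \<in> cl p \<longleftrightarrow> v \<in> cl p"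
        using W conn_incl[OF uv] by (auto simp: cl_def intro: conn_trans conn_sym)
      then show "(u \<in> cl p \<and> (x, u) \<in> conn T) = (v \<in> cl p \<and> (x, v) \<in> conn T)"
        using conn_T[OF uv] by (blast intro: conn_trans conn_sym)
    qed (use px in auto)
    then show ?thesis by simp
  qed
  then have "components (cl p) T = (\<lambda>u. cl p) ` cl p"
    unfolding components_alt by (intro image_cong) (auto intro: conn_trans conn_sym)
  also have "\<dots> = {cl p}" using px by auto
  finally show False using le T by simp
qed

text \<open>By balance the class of a point of \<open>e\<close> contains two or four of these
  points, and four is excluded. The partner of \<open>x\<close> is \<open>b x\<close>,
  \<open>y\<close> or \<open>b y\<close>, and the other two points are then partners as
  well.\<close>

lemma cut_cases:
  obtains
    (parallel) "(x, b x) \<in> conn cut" "(y, b y) \<in> conn cut" "(x, y) \<notin> conn cut"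
  | (straight) "(x, y) \<in> conn cut" "(b x, b y) \<in> conn cut" "(x, b x) \<notin> conn cut"
  | (crossed) "(x, b y) \<in> conn cut" "(b x, y) \<in> conn cut" "(x, b x) \<notin> conn cut"
proof -
  obtain s :: "'w \<Rightarrow> bool" where s: "\<And>u. u \<in> W \<Longrightarrow> s (a u) \<noteq> s u \<and> s (b u) \<noteq> s u"
    using colouring by blast
  define c where "c p q \<longleftrightarrow> (p, q) \<in> conn cut" for p q
  have c: "c p p" "c p q = c q p" "c p q \<Longrightarrow> c q r \<Longrightarrow> c p r" for p q r
    unfolding c_def by (auto intro: conn_sym conn_trans)
  have bal: "(\<Sum>u\<in>e. if c p u then if s u then 1 else - 1 else 0) = (0::int)" for p
  proof -
    have "(\<Sum>u\<in>e. if u \<in> cl p then if s u then 1 else - 1 else 0) = (0::int)"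
      by (rule balanced(3)) (use s in \<open>auto simp: cl_def\<close>)
    moreover have "u \<in> cl p \<longleftrightarrow> c p u" if "u \<in> e" for u using that e_W by (auto simp: cl_def c_def)
    then have "(\<Sum>u\<in>e. if c p u then if s u then 1 else - 1 else 0)
        = (\<Sum>u\<in>e. if u \<in> cl p then if s u then 1 else - 1 else (0::int))" by (intro sum.cong) auto
    ultimately show ?thesis by (simp only:)
  qed
  have four: "\<not> (c x (b x) \<and> c x y \<and> c x (b y))"
    using not_all_four[of x] e_W by (auto simp: cl_def c_def)
  have sx: "s (b x) \<longleftrightarrow> \<not> s x" "s (b y) \<longleftrightarrow> \<not> s y" using s xy by blast+
  have ne: "b x \<noteq> x" "x \<noteq> b x" "y \<noteq> x" "x \<noteq> y" "b y \<noteq> x" "x \<noteq> b y" "b x \<noteq> y" "y \<noteq> b x"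
    "b x \<noteq> b y" "b y \<noteq> b x" "y \<noteq> b y" "b y \<noteq> y" using distinct_e by auto
  \<comment> \<open>Once the sum is expanded over the four distinct points, the cases are decided by
    its signs.\<close>
  have bal': "(if c p x then if s x then 1 else - 1 else 0) + (if c p (b x) then if s (b x) then 1 else - 1 else 0)
     + (if c p y then if s y then 1 else - 1 else 0) + (if c p (b y) then if s (b y) then 1 else - 1 else 0) = (0::int)" for p
    using bal[of p] ne by simp
  consider "c x (b x)" "c y (b y)" "\<not> c x y" | "c x y" "c (b x) (b y)" "\<not> c x (b x)"
    | "c x (b y)" "c (b x) y" "\<not> c x (b x)"
  proof (cases "c x (b x)")
    case True
    have "\<not> c x y" using bal'[of x] four c(1)[of x] True sx by (simp split: if_splits)
    moreover then have "\<not> c y x" "\<not> c y (b x)" using True c by blast+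
    then have "c y (b y)" using bal'[of y] c(1)[of y] by (simp split: if_splits)
    ultimately show ?thesis using that True by blast
  next
    case False
    consider "c x y" | "c x (b y)" using bal'[of x] c(1)[of x] False by (auto split: if_splits)
    then show ?thesis
    proof cases
      case 1
      then have "\<not> c (b x) x" "\<not> c (b x) y" using False c by blast+
      then have "c (b x) (b y)" using bal'[of "b x"] c(1)[of "b x"] by (simp split: if_splits)
      then show ?thesis using 1 False that by blast
    next
      case 2
      then have "\<not> c (b x) x" "\<not> c (b x) (b y)" using False c by blast+
      then have "c (b x) y" using bal'[of "b x"] c(1)[of "b x"] by (simp split: if_splits)
      then show ?thesis using 2 False that by blast
    qed
  qed
  then show thesis using that unfolding c_def by cases blast+
qed

end

section \<open>Ribbon graphs with one edge\<close>

lemma classes_meeting_eq: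
  assumes "e \<subseteq> W"
  shows "{v \<in> components W R. v \<inter> e \<noteq> {}} = (\<lambda>p. {u \<in> W. (p, u) \<in> conn R}) ` e"
    (is "_ = ?cl ` e")
proof (intro equalityI subsetI)
  fix v assume "v \<in> {v \<in> components W R. v \<inter> e \<noteq> {}}"
  then obtain q p where "q \<in> W" "v = ?cl q" "p \<in> v" "p \<in> e" by (auto simp: components_alt)
  moreover then have "?cl q = ?cl p" using component_eq_iff[of q W p R] by auto
  ultimately show "v \<in> ?cl ` e" by blast
next
  fix v assume "v \<in> ?cl ` e"
  then obtain p where "p \<in> e" "v = ?cl p" by blast
  moreover then have "p \<in> W" "p \<in> v" using assms by auto
  ultimately show "v \<in> {v \<in> components W R. v \<inter> e \<noteq> {}}" by (auto simp: components_alt)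
qed

text \<open>The colour classes have disjoint point sets, so \<open>block_rel\<close> already is an
  equivalence on \<open>W\<close> and its closure joins no further points there.\<close>

lemma block_rel_in_classes:
  assumes V: "partition_on W V" and P: "partition_on V P" and "p \<in> W" "(p, q) \<in> conn (block_rel P)"
  shows "\<exists>C\<in>P. p \<in> \<Union>C \<and> q \<in> \<Union>C"
proof -
  have UV: "\<Union>V = W" and UP: "\<Union>P = V" using V P by (auto simp: partition_on_def)
  note uniq = block_unique[OF V P]
  obtain C where C: "C \<in> P" "p \<in> \<Union>C" using assms(3) UV UP by blast
  have "q \<in> \<Union>C" using assms(4)
  proof (rule conn_invariant)
    fix u v assume "(u, v) \<in> block_rel P"
    then obtain D where "D \<in> P" "u \<in> \<Union>D" "v \<in> \<Union>D" by (auto simp: block_rel_def)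
    then show "u \<in> \<Union>C \<longleftrightarrow> v \<in> \<Union>C" using uniq[OF C(1)] by metis
  qed (rule C(2))
  then show ?thesis using C by blast
qed

text \<open>Every block that meets \<open>e\<close> contains \<open>x\<close> or \<open>y\<close>,
  so comparing these two points suffices. The pairs \<open>x\<close>, \<open>x'\<close> and
  \<open>y\<close>, \<open>y'\<close> are the slots of the edge in the case of vertices and its
  sides in the case of boundary components.\<close>

lemma same_class_iff:
  assumes V: "partition_on W V" and P: "partition_on V P"
    and e: "e = {x, x', y, y'}" "e \<subseteq> W"
    and xx: "\<And>v. v \<in> V \<Longrightarrow> x \<in> v \<longleftrightarrow> x' \<in> v" and yy: "\<And>v. v \<in> V \<Longrightarrow> y \<in> v \<longleftrightarrow> y' \<in> v"
  shows "same_class P {v \<in> V. v \<inter> e \<noteq> {}} \<longleftrightarrow> (x, y) \<in> conn (block_rel P)"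
proof
  have UV: "\<Union>V = W" and UP: "\<Union>P = V" using V P by (auto simp: partition_on_def)
  assume "same_class P {v \<in> V. v \<inter> e \<noteq> {}}"
  then obtain C where C: "C \<in> P" "{v \<in> V. v \<inter> e \<noteq> {}} \<subseteq> C" by (auto simp: same_class_def)
  have "p \<in> \<Union>C" if p: "p \<in> e" for p
  proof -
    have "p \<in> \<Union>V" using p e UV by blast
    then obtain v where "v \<in> V" "p \<in> v" by (rule UnionE)
    then show ?thesis using C(2) p by blast
  qed
  then have "x \<in> \<Union>C" "y \<in> \<Union>C" using e(1) by simp_all
  then have "(x, y) \<in> block_rel P" using C(1) unfolding block_rel_def by blast
  then show "(x, y) \<in> conn (block_rel P)" by (rule conn_incl)
next
  have UV: "\<Union>V = W" and UP: "\<Union>P = V" using V P by (auto simp: partition_on_def)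
  have dis: "v = w" if "v \<in> V" "w \<in> V" "p \<in> v" "p \<in> w" for v w p
    using that V unfolding partition_on_def disjoint_def by blast
  assume "(x, y) \<in> conn (block_rel P)"
  then obtain C v w where C: "C \<in> P" "v \<in> C" "w \<in> C" "x \<in> v" "y \<in> w"
    using block_rel_in_classes[OF V P, of x y] e by blast
  have vw: "v \<in> V" "w \<in> V" using C UP by auto
  have "u \<in> C" if u: "u \<in> V" "u \<inter> e \<noteq> {}" for u
  proof -
    have "x \<in> u \<or> y \<in> u" using u e xx[OF u(1)] yy[OF u(1)] by blast
    then have "u = v \<or> u = w" using dis[OF u(1) vw(1), of x] dis[OF u(1) vw(2), of y] C by blast
    then show ?thesis using C by blast
  qed
  then show "same_class P {v \<in> V. v \<inter> e \<noteq> {}}" unfolding same_class_def using C by blast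
qed

text \<open>Given the two pairs inside blocks, joining all of \<open>e\<close> amounts to the single
  new pair \<open>(x, y)\<close>, which costs one class or none.\<close>

lemma num_classes_merge_classes:
  assumes "finite W" and V: "partition_on W V" and P: "partition_on V P"
    and e: "e = {x, x', y, y'}" "e \<subseteq> W"
    and xx: "\<And>v. v \<in> V \<Longrightarrow> x \<in> v \<longleftrightarrow> x' \<in> v" and yy: "\<And>v. v \<in> V \<Longrightarrow> y \<in> v \<longleftrightarrow> y' \<in> v"
  shows "num_classes W (block_rel P)
    = num_classes W (block_rel P \<union> e \<times> e) + (if same_class P {v \<in> V. v \<inter> e \<noteq> {}} then 0 else 1)"
proof -
  have UV: "\<Union>V = W" and UP: "\<Union>P = V" using V P by (auto simp: partition_on_def)
  have rel: "(p, q) \<in> block_rel P" if "p \<in> v" "q \<in> v" "v \<in> V" for p q v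
    using that UP by (auto simp: block_rel_def)
  obtain v w where "v \<in> V" "x \<in> v" "w \<in> V" "y \<in> w" using e UV by blast
  then have rels: "(x, x') \<in> block_rel P" "(y, y') \<in> block_rel P"
    using rel[of x v x'] rel[of y w y'] xx[of v] yy[of w] by auto
  let ?I = "insert (x, y) (block_rel P)"
  have "(x, x') \<in> conn ?I" "(x, y) \<in> conn ?I" "(y, y') \<in> conn ?I"
    using rels by (auto intro: conn_incl)
  then have x: "(x, p) \<in> conn ?I" if "p \<in> e" for p
    using that conn_trans[of x y ?I y'] unfolding e(1) by auto
  have "components W (block_rel P \<union> e \<times> e) = components W ?I"
  proof (rule components_eqI)
    have "e \<times> e \<subseteq> conn ?I" using x by (auto intro: conn_trans conn_sym)
    then show "block_rel P \<union> e \<times> e \<subseteq> conn ?I" by (auto intro: conn_incl)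
    have "?I \<subseteq> block_rel P \<union> e \<times> e" using e(1) by auto
    then show "?I \<subseteq> conn (block_rel P \<union> e \<times> e)" by (rule order_trans) (auto intro: conn_incl)
  qed
  moreover have "x \<in> W" "y \<in> W" using e by auto
  ultimately show ?thesis
    using same_class_iff[OF V P e xx yy] num_classes_insert_conn[of x y "block_rel P" W]
      num_classes_insert_not_conn[OF assms(1), of x y "block_rel P"] by simp
qed

section \<open>Vertices and boundary components counted from the cut relation\<close>

context cut_slots
begin

definition slots_rel :: "('w \<times> 'w) set" where
  "slots_rel = {(u, a u) |u. u \<in> W} \<union> {(u, b u) |u. u \<in> W}"

definition sides_rel :: "('w \<Rightarrow> 'w) \<Rightarrow> ('w \<times> 'w) set" where
  "sides_rel d = {(u, a u) |u. u \<in> W} \<union> {(u, d u) |u. u \<in> e} \<union> {(u, b u) |u. u \<in> W - e}"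

text \<open>Adding the two slots to \<open>cut\<close> restores the vertex circles, and adding the
  two sides instead gives the boundary circles, as the next lemma shows. Both numbers can thus be
  compared with the classes of \<open>cut\<close>.\<close>

lemma conn_slots_rel: "conn slots_rel = conn (insert (x, b x) (insert (y, b y) cut))"
proof (rule equalityI; rule conn_minimal)
  let ?R = "insert (x, b x) (insert (y, b y) cut)"
  have "(u, b u) \<in> conn ?R" if "u \<in> W" for u
  proof (cases "u \<in> e")
    case True
    have "(x, b x) \<in> conn ?R" "(y, b y) \<in> conn ?R" by (rule conn_incl, simp)+
    moreover then have "(b x, x) \<in> conn ?R" "(b y, y) \<in> conn ?R" by (blast intro: conn_sym)+
    moreover have "b (b x) = x" "b (b y) = y" using b[OF xy(1)] b[OF xy(2)] by simp_all
    ultimately show ?thesis using True by auto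
  next
    case False
    then show ?thesis using that by (intro conn_incl) (auto simp: cut_def)
  qed
  moreover have "(u, a u) \<in> conn ?R" if "u \<in> W" for u
    using that by (intro conn_incl) (auto simp: cut_def)
  ultimately show "slots_rel \<subseteq> conn ?R" by (auto simp: slots_rel_def)
  show "?R \<subseteq> conn slots_rel" using xy by (auto simp: cut_def slots_rel_def intro!: conn_incl)
qed

lemma conn_sides_rel:
  assumes d: "d x = y" "d y = x" "d (b x) = b y" "d (b y) = b x"
  shows "conn (sides_rel d) = conn (insert (b x, b y) (insert (x, y) cut))"
proof (rule equalityI; rule conn_minimal)
  let ?R = "insert (b x, b y) (insert (x, y) cut)"
  have "(u, d u) \<in> conn ?R" if "u \<in> e" for u
  proof -
    have "(x, y) \<in> conn ?R" "(b x, b y) \<in> conn ?R" by (rule conn_incl, simp)+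
    moreover then have "(y, x) \<in> conn ?R" "(b y, b x) \<in> conn ?R" by (blast intro: conn_sym)+
    ultimately show ?thesis using that d by auto
  qed
  moreover have "(u, a u) \<in> conn ?R" if "u \<in> W" for u
    using that by (intro conn_incl) (auto simp: cut_def)
  moreover have "(u, b u) \<in> conn ?R" if "u \<in> W - e" for u
    using that unfolding cut_def by (intro conn_incl) blast
  ultimately show "sides_rel d \<subseteq> conn ?R" unfolding sides_rel_def by blast
  have "(x, d x) \<in> sides_rel d" "(b x, d (b x)) \<in> sides_rel d" unfolding sides_rel_def by blast+
  moreover have "cut \<subseteq> sides_rel d" unfolding cut_def sides_rel_def by blast
  ultimately show "?R \<subseteq> conn (sides_rel d)" using d by (auto intro: conn_incl)
qed

lemma conn_insertI: "(u, v) \<in> conn R \<Longrightarrow> (u, v) \<in> conn (insert p R)"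
  by (rule subsetD[OF conn_mono[OF subset_insertI]])

text \<open>Both slots join points that \<open>cut\<close> already connects. The first side fuses
  two classes, after which the second is redundant.\<close>

lemma parallel_counts:
  assumes d: "d x = y" "d y = x" "d (b x) = b y" "d (b y) = b x"
    and c: "(x, b x) \<in> conn cut" "(y, b y) \<in> conn cut" "(x, y) \<notin> conn cut"
  shows "num_classes W slots_rel = Suc (num_classes W (sides_rel d))"
    and "(x, y) \<notin> conn slots_rel" and "(x, b x) \<in> conn (sides_rel d)"
proof -
  note eqs = components_cong[of W slots_rel "insert (x, b x) (insert (y, b y) cut)"]
    components_cong[of W "sides_rel d" "insert (b x, b y) (insert (x, y) cut)"]
  have "(x, b x) \<in> conn (insert (y, b y) cut)" using c by (blast intro: conn_insertI)
  then have 1: "num_classes W slots_rel = num_classes W cut"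
    using eqs(1) conn_slots_rel c by (simp add: num_classes_insert_conn)
  have *: "(x, y) \<in> conn (insert (x, y) cut)" "(x, b x) \<in> conn (insert (x, y) cut)"
      "(y, b y) \<in> conn (insert (x, y) cut)"
    using c by (auto intro: conn_incl conn_insertI)
  then have "(b x, b y) \<in> conn (insert (x, y) cut)" by (meson conn_sym conn_trans)
  then have "num_classes W (sides_rel d) = num_classes W (insert (x, y) cut)"
    using eqs(2) conn_sides_rel[OF d] by (simp add: num_classes_insert_conn)
  then show "num_classes W slots_rel = Suc (num_classes W (sides_rel d))"
    using 1 num_classes_insert_not_conn[OF fin xy(1,2) c(3)] by simp
  show "(x, y) \<notin> conn slots_rel"
    unfolding conn_slots_rel conn_insert_iff using c by (meson conn_sym conn_trans)
  show "(x, b x) \<in> conn (sides_rel d)" unfolding conn_sides_rel[OF d] using c by (blast intro: conn_insertI)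
qed

text \<open>This is dual to the parallel case: the sides are redundant, and exactly one of the two
  slots fuses classes.\<close>

lemma straight_counts:
  assumes d: "d x = y" "d y = x" "d (b x) = b y" "d (b y) = b x"
    and c: "(x, y) \<in> conn cut" "(b x, b y) \<in> conn cut" "(x, b x) \<notin> conn cut"
  shows "num_classes W (sides_rel d) = Suc (num_classes W slots_rel)" and "(x, y) \<in> conn slots_rel"
proof -
  note eqs = components_cong[of W slots_rel "insert (x, b x) (insert (y, b y) cut)"]
    components_cong[of W "sides_rel d" "insert (b x, b y) (insert (x, y) cut)"]
  have "(b x, b y) \<in> conn (insert (x, y) cut)" using c by (blast intro: conn_insertI)
  then have 1: "num_classes W (sides_rel d) = num_classes W cut"
    using eqs(2) conn_sides_rel[OF d] c by (simp add: num_classes_insert_conn)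
  have *: "(x, y) \<in> conn (insert (x, b x) cut)" "(b x, b y) \<in> conn (insert (x, b x) cut)"
      "(x, b x) \<in> conn (insert (x, b x) cut)"
    using c by (auto intro: conn_incl conn_insertI)
  then have yby: "(y, b y) \<in> conn (insert (x, b x) cut)" by (meson conn_sym conn_trans)
  then have "num_classes W slots_rel = num_classes W (insert (x, b x) cut)"
    using eqs(1) conn_slots_rel num_classes_insert_conn[OF yby, of W] by (simp add: insert_commute)
  moreover have "b x \<in> W" using b[OF xy(1)] by simp
  ultimately show "num_classes W (sides_rel d) = Suc (num_classes W slots_rel)"
    using 1 num_classes_insert_not_conn[OF fin xy(1) _ c(3)] by simp
  show "(x, y) \<in> conn slots_rel" unfolding conn_slots_rel using c by (blast intro: conn_insertI)
qed

text \<open>Here one slot and one side each fuse two classes of \<open>cut\<close>, and the other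
  slot and side are redundant, so both numbers drop by one.\<close>

lemma crossed_counts:
  assumes d: "d x = y" "d y = x" "d (b x) = b y" "d (b y) = b x"
    and c: "(x, b y) \<in> conn cut" "(b x, y) \<in> conn cut" "(x, b x) \<notin> conn cut"
  shows "num_classes W (sides_rel d) = num_classes W slots_rel" and "(x, y) \<in> conn slots_rel"
    and "(x, b x) \<in> conn (sides_rel d)"
proof -
  note eqs = components_cong[of W slots_rel "insert (x, b x) (insert (y, b y) cut)"]
    components_cong[of W "sides_rel d" "insert (b x, b y) (insert (x, y) cut)"]
  have nc: "(x, y) \<notin> conn cut" using c by (meson conn_sym conn_trans)
  have *: "(x, b y) \<in> conn (insert (x, b x) cut)" "(b x, y) \<in> conn (insert (x, b x) cut)"
      "(x, b x) \<in> conn (insert (x, b x) cut)"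
    using c by (auto intro: conn_incl conn_insertI)
  then have yby: "(y, b y) \<in> conn (insert (x, b x) cut)" and xy': "(x, y) \<in> conn (insert (x, b x) cut)"
    by (meson conn_sym conn_trans)+
  then have 1: "num_classes W slots_rel = num_classes W (insert (x, b x) cut)"
    using eqs(1) conn_slots_rel num_classes_insert_conn[OF yby, of W] by (simp add: insert_commute)
  have **: "(x, b y) \<in> conn (insert (x, y) cut)" "(b x, y) \<in> conn (insert (x, y) cut)"
      "(x, y) \<in> conn (insert (x, y) cut)"
    using c by (auto intro: conn_incl conn_insertI)
  then have bxy: "(b x, b y) \<in> conn (insert (x, y) cut)" and xbx: "(x, b x) \<in> conn (insert (x, y) cut)"
    by (meson conn_sym conn_trans)+
  then have 2: "num_classes W (sides_rel d) = num_classes W (insert (x, y) cut)"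
    using eqs(2) conn_sides_rel[OF d] by (simp add: num_classes_insert_conn)
  have "b x \<in> W" using b[OF xy(1)] by simp
  then show "num_classes W (sides_rel d) = num_classes W slots_rel"
    using 1 2 num_classes_insert_not_conn[OF fin xy(1) _ c(3)] num_classes_insert_not_conn[OF fin xy(1,2) nc]
    by simp
  show "(x, y) \<in> conn slots_rel"
    unfolding conn_slots_rel using conn_insertI[OF xy', of "(y, b y)"] by (simp add: insert_commute)
  show "(x, b x) \<in> conn (sides_rel d)" unfolding conn_sides_rel[OF d] by (intro conn_insertI xbx)
qed

lemma card_classes_meeting:
  assumes "(p, p') \<in> conn R" "(q, q') \<in> conn R" "{p, p', q, q'} = e"
  shows "card {v \<in> components W R. v \<inter> e \<noteq> {}} = (if (p, q) \<in> conn R then 1 else 2)"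
proof -
  define cl where "cl p = {u \<in> W. (p, u) \<in> conn R}" for p
  have W: "p \<in> W" "p' \<in> W" "q \<in> W" "q' \<in> W" using e_W unfolding assms(3)[symmetric] by simp_all
  then have "cl p = cl p'" "cl q = cl q'" "cl p = cl q \<longleftrightarrow> (p, q) \<in> conn R"
    using component_eq_iff[of p W p' R] component_eq_iff[of q W q' R] component_eq_iff[of p W q R] assms(1,2)
    unfolding cl_def by simp_all
  moreover have "{v \<in> components W R. v \<inter> e \<noteq> {}} = cl ` {p, p', q, q'}"
    using classes_meeting_eq[OF e_W, of R] assms(3) unfolding cl_def by metis
  ultimately show ?thesis by (cases "(p, q) \<in> conn R") simp_all
qed

text \<open>The class of \<open>x\<close> meets \<open>e\<close> exactly in \<open>x\<close> and
  \<open>y\<close>, and balance makes their colours opposite.\<close>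

lemma straight_flip:
  assumes c: "(x, y) \<in> conn cut" "(b x, b y) \<in> conn cut" "(x, b x) \<notin> conn cut"
    and s: "\<And>u. u \<in> cl x \<Longrightarrow> s (a u) \<noteq> (s u :: bool) \<and> s (b u) \<noteq> s u"
  shows "s x \<noteq> s y"
proof -
  have "(x, b y) \<notin> conn cut" using c by (meson conn_sym conn_trans)
  then have mem: "x \<in> cl x" "y \<in> cl x" "b x \<notin> cl x" "b y \<notin> cl x" using c xy by (auto simp: cl_def)
  have "(\<Sum>u\<in>e. if u \<in> cl x then if s u then 1 else - 1 else 0) = (0::int)"
    by (rule balanced(3)) (rule s)
  then show ?thesis using mem distinct_e by (auto split: if_splits)
qed

lemma crossed_flip:
  assumes c: "(x, b y) \<in> conn cut" "(b x, y) \<in> conn cut" "(x, b x) \<notin> conn cut"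
    and s: "\<And>u. u \<in> cl x \<Longrightarrow> s (a u) \<noteq> (s u :: bool) \<and> s (b u) \<noteq> s u"
  shows "s x \<noteq> s (b y)"
proof -
  have "(x, y) \<notin> conn cut" using c by (meson conn_sym conn_trans)
  moreover have "b y \<in> W" using b[OF xy(2)] by simp
  ultimately have mem: "x \<in> cl x" "y \<notin> cl x" "b x \<notin> cl x" "b y \<in> cl x" using c xy by (auto simp: cl_def)
  have "(\<Sum>u\<in>e. if u \<in> cl x then if s u then 1 else - 1 else 0) = (0::int)"
    by (rule balanced(3)) (rule s)
  then show ?thesis using mem distinct_e by (auto split: if_splits)
qed

end

section \<open>Loops and orientability of a single edge\<close>

lemma Union_edges:
  assumes "ribbon_graph G" shows "\<Union>(edges G) = att G"
proof -
  have "{x, slot G x, side G x, slot G (side G x)} \<subseteq> att G" if "x \<in> att G" for x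
    using assms that by (auto simp: ribbon_graph_def)
  then show ?thesis unfolding edges_def by blast
qed

lemma ribbon_cut_slots:
  assumes "ribbon_graph G" "x \<in> att G"
  shows "cut_slots (pts G) (arc G) (slot G) x (side G x)"
  by unfold_locales (use assms in \<open>auto simp: ribbon_graph_def\<close>)

text \<open>The parallel, straight and crossed pairings give the three cases. In the straight case
  an alternating colouring also changes along the sides, so it is a coherent orientation. In the
  crossed case it changes from \<open>x\<close> to \<open>slot H ?y\<close> and again to
  \<open>?y\<close>, so it cannot change along the side from \<open>x\<close> to
  \<open>?y\<close>.\<close>

lemma one_edge_cases:
  assumes G: "ribbon_graph H" and single: "edges H = {e}"
  obtains
    (nonloop) "card (ends H e) = 2" "card (touching H e) = 1" "card (verts H) = Suc (card (bnds H))"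
  | (orientable) "orientable_loop H e" "card (bnds H) = Suc (card (verts H))"
  | (nonorientable) "nonorientable_loop H e" "card (touching H e) = 1" "card (bnds H) = card (verts H)"
proof -
  obtain x where x: "x \<in> att H" "e = {x, slot H x, side H x, slot H (side H x)}"
    using single unfolding edges_def by blast
  have att: "att H = e" using Union_edges[OF G] single by simp
  let ?y = "side H x"
  interpret cut_slots "pts H" "arc H" "slot H" x ?y by (rule ribbon_cut_slots[OF G x(1)])
  have side: "side H (side H u) = u \<and> side H (slot H u) = slot H (side H u)" if "u \<in> att H" for u
    using G that by (auto simp: ribbon_graph_def)
  have "?y \<in> att H" using x att by blast
  then have d: "side H x = ?y" "side H ?y = x" "side H (slot H x) = slot H ?y" "side H (slot H ?y) = slot H x"
    using side[OF x(1)] side[of ?y] by auto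
  have verts: "verts H = components (pts H) slots_rel"
    by (simp add: verts_def slots_rel_def)
  have bnds: "bnds H = components (pts H) (sides_rel (side H))"
    unfolding bnds_def sides_rel_def att x(2) ..
  have ends: "ends H e = {v \<in> components (pts H) slots_rel. v \<inter> e \<noteq> {}}" by (simp add: ends_def verts)
  have touching: "touching H e = {v \<in> components (pts H) (sides_rel (side H)). v \<inter> e \<noteq> {}}"
    by (simp add: touching_def bnds)
  have "(x, slot H x) \<in> conn slots_rel" "(?y, slot H ?y) \<in> conn slots_rel"
    using xy by (auto intro!: conn_incl simp: slots_rel_def)
  then have card_ends: "card (ends H e) = (if (x, ?y) \<in> conn slots_rel then 1 else 2)"
    unfolding ends unfolding x(2) by (rule card_classes_meeting) simp
  have "(x, side H x) \<in> sides_rel (side H)" "(slot H x, side H (slot H x)) \<in> sides_rel (side H)"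
    unfolding sides_rel_def by blast+
  then have "(x, ?y) \<in> conn (sides_rel (side H))" "(slot H x, slot H ?y) \<in> conn (sides_rel (side H))"
    using d by (auto intro: conn_incl)
  then have card_touching: "card (touching H e) = (if (x, slot H x) \<in> conn (sides_rel (side H)) then 1 else 2)"
    unfolding touching unfolding x(2) by (rule card_classes_meeting) auto
  show thesis
  proof (rule cut_cases)
    assume c: "(x, slot H x) \<in> conn cut" "(?y, slot H ?y) \<in> conn cut" "(x, ?y) \<notin> conn cut"
    show thesis
      using parallel_counts[OF d c] card_ends card_touching by (intro nonloop) (simp_all add: verts bnds)
  next
    assume c: "(x, ?y) \<in> conn cut" "(slot H x, slot H ?y) \<in> conn cut" "(x, slot H x) \<notin> conn cut"
    obtain s :: "'a \<Rightarrow> bool" where s: "\<And>u. u \<in> pts H \<Longrightarrow> s (arc H u) \<noteq> s u \<and> s (slot H u) \<noteq> s u"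
      using colouring by blast
    have "s x \<noteq> s ?y" by (rule straight_flip[OF c]) (use s in \<open>auto simp: cl_def\<close>)
    moreover have "s (slot H x) \<noteq> s x" "s (slot H ?y) \<noteq> s ?y" using s xy by blast+
    ultimately have "\<forall>u\<in>e. s (side H u) \<noteq> s u" using d unfolding x(2) by auto
    moreover have "\<Union>(ends H e) \<subseteq> pts H" unfolding ends by (auto simp: components_alt)
    moreover have "loop H e" unfolding loop_def card_ends using straight_counts(2)[OF d c] by simp
    ultimately have "orientable_loop H e" unfolding orientable_loop_def using s by blast
    then show thesis using straight_counts(1)[OF d c] by (intro orientable) (simp_all add: verts bnds)
  next
    assume c: "(x, slot H ?y) \<in> conn cut" "(slot H x, ?y) \<in> conn cut" "(x, slot H x) \<notin> conn cut"
    have loop: "loop H e" unfolding loop_def card_ends using crossed_counts(2)[OF d c] by simp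
    have "\<not> orientable_loop H e"
    proof
      assume "orientable_loop H e"
      then obtain s :: "'a \<Rightarrow> bool" where s: "\<forall>u\<in>\<Union>(ends H e). s (arc H u) \<noteq> s u \<and> s (slot H u) \<noteq> s u"
        "\<forall>u\<in>e. s (side H u) \<noteq> s u" unfolding orientable_loop_def by (elim conjE exE)
      have ends': "ends H e = (\<lambda>p. {u \<in> pts H. (p, u) \<in> conn slots_rel}) ` e"
        unfolding ends unfolding x(2) by (rule classes_meeting_eq[OF e_W])
      \<comment> \<open>An orientation alternates only on the discs at the ends of \<open>e\<close>;
        the class \<open>cl x\<close> has to lie on these discs before balance applies.\<close>
      have "cut \<subseteq> slots_rel" unfolding cut_def slots_rel_def by blast
      then have "conn cut \<subseteq> conn slots_rel" by (rule conn_mono)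
      moreover have "x \<in> e" "?y \<in> e" unfolding x(2) by blast+
      ultimately have "cl x \<subseteq> \<Union>(ends H e)" and y: "?y \<in> \<Union>(ends H e)"
        unfolding ends' cl_def using xy(2) conn_refl[of ?y slots_rel] by blast+
      then have "s x \<noteq> s (slot H ?y)" using crossed_flip[OF c, of s] s(1) by blast
      moreover have "s (slot H ?y) \<noteq> s ?y" using s(1) y by blast
      moreover have "s ?y \<noteq> s x" using s(2) x(2) by blast
      ultimately show False by blast
    qed
    then have "nonorientable_loop H e" using loop by (simp add: nonorientable_loop_def)
    then show thesis using crossed_counts[OF d c] card_touching
      by (intro nonorientable) (simp_all add: verts bnds)
  qed
qed

section \<open>Minors and ranks\<close>

definition vert_rel :: "('p, 'z) ribbon_graph_scheme \<Rightarrow> ('p \<times> 'p) set" where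
  "vert_rel G = {(x, arc G x) |x. x \<in> pts G} \<union> {(x, slot G x) |x. x \<in> pts G}"

definition bnd_rel :: "('p, 'z) ribbon_graph_scheme \<Rightarrow> ('p \<times> 'p) set" where
  "bnd_rel G = {(x, arc G x) |x. x \<in> pts G} \<union> {(x, side G x) |x. x \<in> att G} \<union>
      {(x, slot G x) |x. x \<in> pts G - att G}"

lemma verts_eq: "verts G = components (pts G) (vert_rel G)"
  by (simp add: verts_def vert_rel_def)

lemma bnds_eq: "bnds G = components (pts G) (bnd_rel G)"
  by (simp add: bnds_def bnd_rel_def)

definition vertex_comps :: "'p coloured_ribbon_graph \<Rightarrow> 'p set set \<Rightarrow> nat" where
  "vertex_comps G A = card (mcomponents (vertex_quotient G) A)"

text \<open>With the complement built in, all three counts obey one rule: for \<open>e\<close>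
  outside \<open>A\<close>, deletion keeps \<open>A\<close> and contraction turns it into
  \<open>insert e A\<close>.\<close>

definition boundary_comps :: "'p coloured_ribbon_graph \<Rightarrow> 'p set set \<Rightarrow> nat" where
  "boundary_comps G A = card (mcomponents (boundary_quotient G) (edges G - A))"

definition num_bnds :: "'p coloured_ribbon_graph \<Rightarrow> 'p set set \<Rightarrow> nat" where
  "num_bnds G A = card (bnds (ribbon_subgraph G A))"

locale ribbon =
  fixes G :: "'p coloured_ribbon_graph"
  assumes G: "coloured_ribbon_graph G"
begin

lemma rg: "ribbon_graph G"
  and part_v: "partition_on (verts G) (vclasses G)"
  and part_b: "partition_on (bnds G) (bclasses G)"
  using G by (auto simp: coloured_ribbon_graph_def)

lemma finite_pts: "finite (pts G)" and att_pts: "att G \<subseteq> pts G"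
  using rg by (auto simp: ribbon_graph_def)

lemma arc: "x \<in> pts G \<Longrightarrow> arc G x \<in> pts G \<and> arc G x \<noteq> x \<and> arc G (arc G x) = x"
  and slot: "x \<in> pts G \<Longrightarrow> slot G x \<in> pts G \<and> slot G x \<noteq> x \<and> slot G (slot G x) = x"
  and slot_att: "x \<in> att G \<Longrightarrow> slot G x \<in> att G"
  and side: "x \<in> att G \<Longrightarrow> side G x \<in> att G \<and> side G x \<noteq> x \<and> side G x \<noteq> slot G x \<and>
        side G (side G x) = x \<and> side G (slot G x) = slot G (side G x)"
  using rg by (auto simp: ribbon_graph_def)

lemma edge_sub: "e \<in> edges G \<Longrightarrow> e \<subseteq> att G"
  using Union_edges[OF rg] by blast

lemma edge_sub_pts: "e \<in> edges G \<Longrightarrow> e \<subseteq> pts G"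
  using edge_sub att_pts by blast

lemma finite_edges: "finite (edges G)"
proof -
  have "edges G \<subseteq> Pow (pts G)" using edge_sub_pts by blast
  then show ?thesis using finite_pts finite_subset by blast
qed

text \<open>An edge is an orbit of the commuting involutions \<open>slot\<close> and
  \<open>side\<close>, so any of its points generates it. This makes edges disjoint.\<close>

lemma edge_eq:
  assumes "e \<in> edges G" "x \<in> e"
  shows "e = {x, slot G x, side G x, slot G (side G x)}"
proof -
  obtain y where y: "y \<in> att G" "e = {y, slot G y, side G y, slot G (side G y)}"
    using assms unfolding edges_def by blast
  have s: "slot G y \<in> att G" "side G y \<in> att G" using y slot_att side by blast+
  have "slot G (slot G y) = y" "slot G (slot G (side G y)) = side G y" using slot att_pts s y by blast+
  moreover have "side G (side G y) = y" "side G (slot G y) = slot G (side G y)" using side y by blast+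
  moreover have "side G (slot G (side G y)) = slot G y" using side[OF s(2)] side[OF y(1)] by simp
  moreover have "x = y \<or> x = slot G y \<or> x = side G y \<or> x = slot G (side G y)" using assms y by blast
  ultimately show ?thesis unfolding y(2) by (elim disjE) auto
qed

lemma edge_ne: "e \<in> edges G \<Longrightarrow> e \<noteq> {}"
  unfolding edges_def by blast

lemma edge_slot:
  assumes "e \<in> edges G" "x \<in> pts G"
  shows "slot G x \<in> e \<longleftrightarrow> x \<in> e"
proof -
  have "slot G y \<in> e" if "y \<in> e" for y using edge_eq[OF assms(1) that] by blast
  then show ?thesis using slot[OF assms(2)] by metis
qed

lemma edge_side:
  assumes "e \<in> edges G" "x \<in> att G"
  shows "side G x \<in> e \<longleftrightarrow> x \<in> e"
proof -
  have "side G y \<in> e" if "y \<in> e" for y using edge_eq[OF assms(1) that] by blast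
  then show ?thesis using side[OF assms(2)] by metis
qed

lemma edge_disjoint: "e \<in> edges G \<Longrightarrow> f \<in> edges G \<Longrightarrow> x \<in> e \<Longrightarrow> x \<in> f \<Longrightarrow> e = f"
  using edge_eq[of e x] edge_eq[of f x] by simp

lemma edges_without:
  assumes "e \<in> edges G"
  shows "{{x, slot G x, side G x, slot G (side G x)} |x. x \<in> att G - e} = edges G - {e}"
proof (intro equalityI subsetI)
  fix f assume "f \<in> edges G - {e}"
  then obtain x where x: "x \<in> att G" "f = {x, slot G x, side G x, slot G (side G x)}" "f \<noteq> e"
    unfolding edges_def by blast
  then have "x \<notin> e" using edge_eq[OF assms] by metis
  then show "f \<in> {{x, slot G x, side G x, slot G (side G x)} |x. x \<in> att G - e}" using x by blast
next
  fix f assume "f \<in> {{x, slot G x, side G x, slot G (side G x)} |x. x \<in> att G - e}"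
  then obtain x where x: "x \<in> att G" "x \<notin> e" "f = {x, slot G x, side G x, slot G (side G x)}" by blast
  then have "f \<noteq> e" by blast
  then show "f \<in> edges G - {e}" using x unfolding edges_def by blast
qed

lemma vertex_comps_alt:
  assumes "A \<subseteq> edges G"
  shows "vertex_comps G A = num_classes (pts G) (block_rel (vclasses G) \<union> (\<Union>a\<in>A. a \<times> a))"
proof -
  have "partition_on (pts G) (verts G)" unfolding verts_eq by (rule partition_components)
  moreover have "\<And>a. a \<in> A \<Longrightarrow> a \<subseteq> pts G" using assms edge_sub_pts by blast
  ultimately show ?thesis
    using num_classes_quotient[OF _ part_v, of "pts G" A]
    by (simp add: vertex_comps_def mcomponents_def vertex_quotient_def ends_def)
qed

lemma boundary_comps_alt: "boundary_comps G A = num_classes (pts G) (block_rel (bclasses G) \<union> (\<Union>a\<in>edges G - A. a \<times> a))"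
proof -
  have "partition_on (pts G) (bnds G)" unfolding bnds_eq by (rule partition_components)
  moreover have "\<And>a. a \<in> edges G - A \<Longrightarrow> a \<subseteq> pts G" using edge_sub_pts by blast
  ultimately show ?thesis
    using num_classes_quotient[OF _ part_b, of "pts G" "edges G - A"]
    by (simp add: boundary_comps_def mcomponents_def boundary_quotient_def touching_def)
qed

text \<open>With all slots vacant the boundary circles are the vertex circles.\<close>

lemma num_bnds_empty: "num_bnds G {} = card (verts G)"
  by (simp add: num_bnds_def ribbon_subgraph_def bnds_def verts_def)

lemma num_bnds_edges: "num_bnds G (edges G) = card (bnds G)"
  by (simp add: num_bnds_def ribbon_subgraph_def Union_edges[OF rg])

end

section \<open>The three counts under deletion and contraction\<close>

lemma delete_simps [simp]:
  "pts (delete G e) = pts G" "arc (delete G e) = arc G" "slot (delete G e) = slot G"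
  "side (delete G e) = side G" "att (delete G e) = att G - e" "vclasses (delete G e) = vclasses G"
  by (simp_all add: delete_def Let_def)

lemma contract_simps [simp]:
  "pts (contract G e) = pts G" "arc (contract G e) = arc G" "side (contract G e) = side G"
  "slot (contract G e) = (\<lambda>x. if x \<in> e then side G x else slot G x)"
  "att (contract G e) = att G - e" "bclasses (contract G e) = bclasses G"
  by (simp_all add: contract_def Let_def)

lemma verts_delete [simp]: "verts (delete G e) = verts G"
  by (simp add: verts_def)

lemma bclasses_delete:
  "bclasses (delete G e) = replace_in (bclasses G) {v \<in> bnds G. v \<inter> e \<noteq> {}} {v \<in> bnds (delete G e). v \<inter> e \<noteq> {}}"
proof -
  have "bnds (G\<lparr>att := att G - e\<rparr>) = bnds (delete G e)" by (simp add: bnds_def)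
  then show ?thesis unfolding delete_def Let_def by (simp add: touching_def)
qed

lemma vclasses_contract:
  "vclasses (contract G e) = replace_in (vclasses G) {v \<in> verts G. v \<inter> e \<noteq> {}} {v \<in> verts (contract G e). v \<inter> e \<noteq> {}}"
proof -
  have "verts (G\<lparr>slot := (\<lambda>x. if x \<in> e then side G x else slot G x), att := att G - e\<rparr>) = verts (contract G e)"
    by (simp add: verts_def)
  then show ?thesis unfolding contract_def Let_def by (simp add: ends_def)
qed

context ribbon
begin

lemma slot_side_off_edge:
  assumes "e \<in> edges G" "x \<in> att G - e"
  shows "slot G x \<in> att G - e" and "side G x \<in> att G - e"
  using assms slot_att side edge_slot[OF assms(1)] edge_side[OF assms(1)] att_pts by blast+

lemma ribbon_graph_delete:
  assumes "e \<in> edges G" shows "ribbon_graph (delete G e)"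
  unfolding ribbon_graph_def delete_simps
proof (intro conjI ballI)
  fix x assume "x \<in> att G - e"
  then show "slot G x \<in> att G - e" "side G x \<in> att G - e"
    and "side G x \<noteq> x" "side G x \<noteq> slot G x" "side G (side G x) = x" "side G (slot G x) = slot G (side G x)"
    using slot_side_off_edge[OF assms] side by blast+
qed (use finite_pts att_pts arc slot in blast)+

lemma edges_delete:
  assumes "e \<in> edges G" shows "edges (delete G e) = edges G - {e}"
  using edges_without[OF assms] by (simp add: edges_def)

lemma bnd_rel_delete:
  assumes "e \<in> edges G"
  shows "bnd_rel G - e \<times> e = bnd_rel (delete G e) - e \<times> e"
proof -
  have "x \<in> e \<Longrightarrow> slot G x \<in> e \<and> side G x \<in> e \<and> x \<in> att G" for x
    using edge_sub[OF assms] edge_slot[OF assms] edge_side[OF assms] att_pts by blast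
  then show ?thesis unfolding bnd_rel_def by auto
qed

lemma bnd_rel_sub: "bnd_rel G \<subseteq> pts G \<times> pts G" "bnd_rel (delete G e) \<subseteq> pts G \<times> pts G"
  unfolding bnd_rel_def delete_simps using arc slot side att_pts by blast+

lemmas delete_recolouring =
  recolouring[OF bnd_rel_sub bnd_rel_delete edge_sub_pts edge_ne part_b[unfolded bnds_eq]]

lemma coloured_delete:
  assumes e: "e \<in> edges G" shows "coloured_ribbon_graph (delete G e)"
  using ribbon_graph_delete[OF e] part_v delete_recolouring(1)[OF e e e]
  unfolding coloured_ribbon_graph_def by (simp add: bclasses_delete bnds_eq)

lemma vertex_comps_delete: "vertex_comps (delete G e) A = vertex_comps G A"
  by (simp add: vertex_comps_def mcomponents_def vertex_quotient_def ends_def)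

lemma num_bnds_delete: "num_bnds (delete G e) A = num_bnds G A"
  by (simp add: num_bnds_def bnds_def ribbon_subgraph_def)

text \<open>As \<open>e\<close> lies outside \<open>A\<close>, it is one of the edges counted on the
  right. On the left it is gone, but the merge of boundary colour classes contributes the same pairs
  \<open>e \<times> e\<close>.\<close>

lemma boundary_comps_delete:
  assumes e: "e \<in> edges G" "e \<notin> A"
  shows "boundary_comps (delete G e) A = boundary_comps G A"
proof -
  interpret d: ribbon "delete G e" by unfold_locales (rule coloured_delete[OF e(1)])
  let ?S = "\<Union>a\<in>edges G - {e} - A. a \<times> a"
  have "boundary_comps (delete G e) A = num_classes (pts G) (block_rel (bclasses (delete G e)) \<union> ?S)"
    using d.boundary_comps_alt[of A] by (simp add: edges_delete[OF e(1)])
  also have "\<dots> = num_classes (pts G) (block_rel (bclasses G) \<union> e \<times> e \<union> ?S)"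
    unfolding bclasses_delete bnds_eq delete_simps by (rule arg_cong[where f = card], rule delete_recolouring(2)[OF e(1) e(1) e(1)])
  also have "block_rel (bclasses G) \<union> e \<times> e \<union> ?S = block_rel (bclasses G) \<union> (\<Union>a\<in>edges G - A. a \<times> a)"
    using e by blast
  finally show ?thesis by (simp add: boundary_comps_alt)
qed

lemma ribbon_graph_contract:
  assumes "e \<in> edges G" shows "ribbon_graph (contract G e)"
proof -
  define s where "s x = (if x \<in> e then side G x else slot G x)" for x
  have "s x \<in> pts G \<and> s x \<noteq> x \<and> s (s x) = x" if "x \<in> pts G" for x
  proof (cases "x \<in> e")
    case True
    then have x: "x \<in> att G" using edge_sub[OF assms] by blast
    then have "s x = side G x" "s (side G x) = side G (side G x)"
      using True edge_side[OF assms] by (simp_all add: s_def)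
    then show ?thesis using side[OF x] att_pts by auto
  next
    case False
    then have "s x = slot G x" "s (slot G x) = slot G (slot G x)"
      using edge_slot[OF assms that] by (simp_all add: s_def)
    then show ?thesis using slot[OF that] by simp
  qed
  moreover have "s x \<in> att G - e" "side G x \<in> att G - e" "side G x \<noteq> x" "side G x \<noteq> s x"
      "side G (side G x) = x" "side G (s x) = s (side G x)" if "x \<in> att G - e" for x
  proof -
    note off = slot_side_off_edge[OF assms that]
    then have "s x = slot G x" "s (side G x) = slot G (side G x)" using that by (simp_all add: s_def)
    then show "s x \<in> att G - e" "side G x \<in> att G - e" "side G x \<noteq> x" "side G x \<noteq> s x"
      "side G (side G x) = x" "side G (s x) = s (side G x)" using off side[of x] that by simp_all
  qed
  ultimately show ?thesis
    unfolding ribbon_graph_def contract_simps s_def[symmetric]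
    by (intro conjI ballI) (use finite_pts att_pts arc in blast)+
qed

lemma edges_contract:
  assumes "e \<in> edges G" shows "edges (contract G e) = edges G - {e}"
proof -
  have "edges (contract G e) = {{x, slot G x, side G x, slot G (side G x)} |x. x \<in> att G - e}"
    unfolding edges_def contract_simps Setcompr_eq_image
    by (rule image_cong) (use edge_side[OF assms] in \<open>auto simp del: insert_iff\<close>)
  then show ?thesis using edges_without[OF assms] by simp
qed

lemma vert_rel_contract:
  assumes "e \<in> edges G"
  shows "vert_rel G - e \<times> e = vert_rel (contract G e) - e \<times> e"
proof -
  have "x \<in> e \<Longrightarrow> slot G x \<in> e \<and> side G x \<in> e" for x
    using edge_sub[OF assms] edge_slot[OF assms] edge_side[OF assms] att_pts by blast
  then show ?thesis unfolding vert_rel_def by auto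
qed

lemma vert_rel_sub:
  assumes "e \<in> edges G"
  shows "vert_rel G \<subseteq> pts G \<times> pts G" "vert_rel (contract G e) \<subseteq> pts G \<times> pts G"
proof -
  have "x \<in> e \<Longrightarrow> side G x \<in> pts G" for x using edge_sub[OF assms] side att_pts by blast
  then show "vert_rel G \<subseteq> pts G \<times> pts G" "vert_rel (contract G e) \<subseteq> pts G \<times> pts G"
    unfolding vert_rel_def using arc slot by auto
qed

lemmas contract_recolouring =
  recolouring[OF vert_rel_sub vert_rel_contract edge_sub_pts edge_ne part_v[unfolded verts_eq]]

text \<open>The sides of the contracted edge reappear as vacant slots, so they still belong to the
  boundary.\<close>

lemma bnds_contract:
  assumes "e \<in> edges G" shows "bnds (contract G e) = bnds G"
proof -
  have "e \<subseteq> att G" using edge_sub[OF assms] .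
  then have "bnd_rel (contract G e) = bnd_rel G" unfolding bnd_rel_def using att_pts by auto
  then show ?thesis by (simp add: bnds_eq)
qed

lemma coloured_contract:
  assumes e: "e \<in> edges G" shows "coloured_ribbon_graph (contract G e)"
  using ribbon_graph_contract[OF e] part_b contract_recolouring(1)[OF e e e e e]
  unfolding coloured_ribbon_graph_def bnds_contract[OF e] by (simp add: vclasses_contract verts_eq)

lemma boundary_comps_contract:
  assumes e: "e \<in> edges G"
  shows "boundary_comps (contract G e) A = boundary_comps G (insert e A)"
proof -
  have "edges G - {e} - A = edges G - insert e A" by blast
  then show ?thesis
    by (simp add: boundary_comps_def mcomponents_def boundary_quotient_def touching_def bnds_contract[OF e] edges_contract[OF e])
qed

text \<open>On the points of \<open>e\<close> both graphs follow the sides: on the left as vacant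
  slots, on the right because \<open>e\<close> is attached. Disjointness of edges takes care of all
  other points.\<close>

lemma num_bnds_contract:
  assumes e: "e \<in> edges G" and A: "A \<subseteq> edges G - {e}"
  shows "num_bnds (contract G e) A = num_bnds G (insert e A)"
proof -
  have "\<Union>A \<inter> e = {}" using A edge_disjoint[OF e] by blast
  then have "bnd_rel (ribbon_subgraph (contract G e) A) = bnd_rel (ribbon_subgraph G (insert e A))"
    unfolding bnd_rel_def ribbon_subgraph_def using edge_sub_pts[OF e] by auto
  then show ?thesis by (simp add: num_bnds_def bnds_eq ribbon_subgraph_def)
qed

text \<open>The merge of vertex colour classes caused by contracting \<open>e\<close> plays the part
  of the edge \<open>e\<close> in the quotient graph.\<close>

lemma vertex_comps_contract:
  assumes e: "e \<in> edges G" and A: "A \<subseteq> edges G - {e}"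
  shows "vertex_comps (contract G e) A = vertex_comps G (insert e A)"
proof -
  interpret c: ribbon "contract G e" by unfold_locales (rule coloured_contract[OF e])
  let ?S = "\<Union>a\<in>A. a \<times> a"
  have "vertex_comps (contract G e) A = num_classes (pts G) (block_rel (vclasses (contract G e)) \<union> ?S)"
    using c.vertex_comps_alt[of A] A by (simp add: edges_contract[OF e])
  also have "\<dots> = num_classes (pts G) (block_rel (vclasses G) \<union> e \<times> e \<union> ?S)"
    unfolding vclasses_contract verts_eq contract_simps
    by (rule arg_cong[where f = card], rule contract_recolouring(2)[OF e e e e e, unfolded contract_simps])
  also have "block_rel (vclasses G) \<union> e \<times> e \<union> ?S = block_rel (vclasses G) \<union> (\<Union>a\<in>insert e A. a \<times> a)"
    by blast
  also have "insert e A \<subseteq> edges G" using e A by blast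
  note vertex_comps_alt[OF this, symmetric]
  finally show ?thesis .
qed

end

section \<open>Iterated minors\<close>

lemma foldl_delete:
  assumes "coloured_ribbon_graph G" "distinct fs" "set fs \<subseteq> edges G"
  shows "coloured_ribbon_graph (foldl delete G fs) \<and> edges (foldl delete G fs) = edges G - set fs \<and>
    (\<forall>A \<subseteq> edges G - set fs. vertex_comps (foldl delete G fs) A = vertex_comps G A \<and> boundary_comps (foldl delete G fs) A = boundary_comps G A
      \<and> num_bnds (foldl delete G fs) A = num_bnds G A)"
  using assms
proof (induction fs arbitrary: G)
  case (Cons e fs)
  interpret ribbon G by unfold_locales (rule Cons.prems(1))
  have e: "e \<in> edges G" "e \<notin> set fs" using Cons.prems by auto
  have "set fs \<subseteq> edges (delete G e)" using Cons.prems by (auto simp: edges_delete[OF e(1)])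
  then have IH: "coloured_ribbon_graph (foldl delete (delete G e) fs)"
    "edges (foldl delete (delete G e) fs) = edges G - {e} - set fs"
    "\<And>A. A \<subseteq> edges G - {e} - set fs \<Longrightarrow> vertex_comps (foldl delete (delete G e) fs) A = vertex_comps (delete G e) A
      \<and> boundary_comps (foldl delete (delete G e) fs) A = boundary_comps (delete G e) A \<and> num_bnds (foldl delete (delete G e) fs) A = num_bnds (delete G e) A"
    using Cons.IH[of "delete G e"] coloured_delete[OF e(1)] Cons.prems(2) unfolding edges_delete[OF e(1)] by auto
  have eqs: "edges G - {e} - set fs = edges G - set (e # fs)" by auto
  have "boundary_comps (delete G e) A = boundary_comps G A" if "A \<subseteq> edges G - set (e # fs)" for A
    using that by (intro boundary_comps_delete e(1)) auto
  then show ?case using IH unfolding eqs by (simp add: vertex_comps_delete num_bnds_delete)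
qed simp

text \<open>Contracted edges accumulate in the set at which the counts are taken. Only the set of
  these edges appears in the result, so minors formed in different orders have equal counts.\<close>

lemma foldl_contract:
  assumes "coloured_ribbon_graph G" "distinct fs" "set fs \<subseteq> edges G"
  shows "coloured_ribbon_graph (foldl contract G fs) \<and> edges (foldl contract G fs) = edges G - set fs \<and>
    (\<forall>A \<subseteq> edges G - set fs. vertex_comps (foldl contract G fs) A = vertex_comps G (A \<union> set fs)
      \<and> boundary_comps (foldl contract G fs) A = boundary_comps G (A \<union> set fs) \<and> num_bnds (foldl contract G fs) A = num_bnds G (A \<union> set fs))"
  using assms
proof (induction fs arbitrary: G)
  case (Cons e fs)
  interpret ribbon G by unfold_locales (rule Cons.prems(1))
  have e: "e \<in> edges G" "e \<notin> set fs" using Cons.prems by auto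
  have sub: "set fs \<subseteq> edges (contract G e)" using Cons.prems by (auto simp: edges_contract[OF e(1)])
  then have IH: "coloured_ribbon_graph (foldl contract (contract G e) fs)"
    "edges (foldl contract (contract G e) fs) = edges G - {e} - set fs"
    "\<And>A. A \<subseteq> edges G - {e} - set fs \<Longrightarrow> vertex_comps (foldl contract (contract G e) fs) A = vertex_comps (contract G e) (A \<union> set fs)
      \<and> boundary_comps (foldl contract (contract G e) fs) A = boundary_comps (contract G e) (A \<union> set fs)
      \<and> num_bnds (foldl contract (contract G e) fs) A = num_bnds (contract G e) (A \<union> set fs)"
    using Cons.IH[of "contract G e"] coloured_contract[OF e(1)] Cons.prems(2) unfolding edges_contract[OF e(1)] by auto
  have eqs: "edges G - {e} - set fs = edges G - set (e # fs)" by auto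
  have "A \<union> set fs \<subseteq> edges G - {e}" "insert e (A \<union> set fs) = A \<union> set (e # fs)"
    if "A \<subseteq> edges G - set (e # fs)" for A
    using that sub by (auto simp: edges_contract[OF e(1)])
  then have "vertex_comps (contract G e) (A \<union> set fs) = vertex_comps G (A \<union> set (e # fs))
      \<and> boundary_comps (contract G e) (A \<union> set fs) = boundary_comps G (A \<union> set (e # fs))
      \<and> num_bnds (contract G e) (A \<union> set fs) = num_bnds G (A \<union> set (e # fs))"
    if "A \<subseteq> edges G - set (e # fs)" for A
    using that vertex_comps_contract[OF e(1), of "A \<union> set fs"] boundary_comps_contract[OF e(1), of "A \<union> set fs"]
      num_bnds_contract[OF e(1), of "A \<union> set fs"] by metis
  then show ?case using IH unfolding eqs by simp
qed simp

text \<open>Integral versions of the ranks: these are \<open>r1\<close>, \<open>2 * r2\<close>, \<open>r3\<close> and \<open>2 * r4\<close>.\<close>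

definition rank1 :: "'p coloured_ribbon_graph \<Rightarrow> 'p set set \<Rightarrow> int" where
  "rank1 G A = int (vertex_comps G {}) - int (vertex_comps G A)"

definition rank3 :: "'p coloured_ribbon_graph \<Rightarrow> 'p set set \<Rightarrow> int" where
  "rank3 G A = int (boundary_comps G A) - int (boundary_comps G {})"

definition rank2 :: "'p coloured_ribbon_graph \<Rightarrow> 'p set set \<Rightarrow> int" where
  "rank2 G A = int (card A) + int (num_bnds G {}) - int (num_bnds G A) - 2 * rank1 G A"

definition rank4 :: "'p coloured_ribbon_graph \<Rightarrow> 'p set set \<Rightarrow> int" where
  "rank4 G A = int (card A) - int (num_bnds G {}) + int (num_bnds G A) - 2 * rank3 G A"

text \<open>These four functions give the exponents of the generators in the coefficients of a type.
  The second and fourth refer to doubled ranks, hence the value 2 for \<open>Bp\<close> and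
  \<open>Olh\<close>; a non-orientable loop adds 1 to both, which is why its coefficients are
  products of two square roots.\<close>

primrec type_rank1 :: "etype \<Rightarrow> nat" where
  "type_rank1 Bs = 1" | "type_rank1 Bp = 0" | "type_rank1 Olc = 0" | "type_rank1 Olh = 0" | "type_rank1 Nl = 0"

primrec type_rank2 :: "etype \<Rightarrow> nat" where
  "type_rank2 Bs = 0" | "type_rank2 Bp = 2" | "type_rank2 Olc = 0" | "type_rank2 Olh = 0" | "type_rank2 Nl = 1"

primrec type_rank3 :: "etype \<Rightarrow> nat" where
  "type_rank3 Bs = 0" | "type_rank3 Bp = 0" | "type_rank3 Olc = 1" | "type_rank3 Olh = 0" | "type_rank3 Nl = 0"

primrec type_rank4 :: "etype \<Rightarrow> nat" where
  "type_rank4 Bs = 0" | "type_rank4 Bp = 0" | "type_rank4 Olc = 0" | "type_rank4 Olh = 2" | "type_rank4 Nl = 1"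

text \<open>Being stated by differences of ranks, this passes between a graph and its
  minors.\<close>

definition increment :: "'p coloured_ribbon_graph \<Rightarrow> 'p set set \<Rightarrow> 'p set set \<Rightarrow> etype \<Rightarrow> bool" where
  "increment G A B t \<longleftrightarrow> rank1 G B = rank1 G A + int (type_rank1 t) \<and> rank2 G B = rank2 G A + int (type_rank2 t)
     \<and> rank3 G B = rank3 G A + int (type_rank3 t) \<and> rank4 G B = rank4 G A + int (type_rank4 t)"

section \<open>Edge types as increments of the ranks\<close>

lemma same_class_single:
  assumes "partition_on V P" "S \<subseteq> V" "card S = 1"
  shows "same_class P S"
proof -
  obtain v where "S = {v}" using assms(3) card_1_singletonE by blast
  then show ?thesis using assms by (auto simp: same_class_def partition_on_def)
qed

lemma component_mem_iff:
  assumes "v \<in> components W R" "(x, y) \<in> R" "x \<in> W" "y \<in> W"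
  shows "x \<in> v \<longleftrightarrow> y \<in> v"
proof -
  have "(x, y) \<in> conn R" using assms(2) by (rule conn_incl)
  then show ?thesis using assms(1,3,4) by (auto simp: components_alt intro: conn_trans conn_sym)
qed

context ribbon
begin

lemma single_edge_comps:
  assumes single: "edges G = {e}"
  shows "vertex_comps G {} = vertex_comps G {e} + (if same_class (vclasses G) (ends G e) then 0 else 1)"
    and "boundary_comps G {e} = boundary_comps G {} + (if same_class (bclasses G) (touching G e) then 0 else 1)"
proof -
  have e: "e \<in> edges G" using single by simp
  then obtain x where x: "x \<in> e" using edge_ne by blast
  let ?y = "side G x"
  have ex: "e = {x, slot G x, ?y, slot G ?y}" by (rule edge_eq[OF e x])
  have x_att: "x \<in> att G" "slot G x \<in> att G" "?y \<in> att G" using x edge_sub[OF e] slot_att side by blast+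
  then have pt: "x \<in> pts G" "slot G x \<in> pts G" "?y \<in> pts G" "slot G ?y \<in> pts G"
    using att_pts slot by blast+
  have "vertex_comps G {} = num_classes (pts G) (block_rel (vclasses G))"
    "vertex_comps G {e} = num_classes (pts G) (block_rel (vclasses G) \<union> e \<times> e)"
    using vertex_comps_alt[of "{}"] vertex_comps_alt[of "{e}"] e by simp_all
  moreover have mem: "x \<in> v \<longleftrightarrow> slot G x \<in> v" "?y \<in> v \<longleftrightarrow> slot G ?y \<in> v" if "v \<in> verts G" for v
  proof -
    have "(x, slot G x) \<in> vert_rel G" "(?y, slot G ?y) \<in> vert_rel G"
      using pt by (auto simp: vert_rel_def)
    then show "x \<in> v \<longleftrightarrow> slot G x \<in> v" "?y \<in> v \<longleftrightarrow> slot G ?y \<in> v"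
      using component_mem_iff that pt unfolding verts_eq by metis+
  qed
  ultimately show "vertex_comps G {} = vertex_comps G {e} + (if same_class (vclasses G) (ends G e) then 0 else 1)"
    using num_classes_merge_classes[OF finite_pts partition_components part_v[unfolded verts_eq]
        ex edge_sub_pts[OF e] mem[unfolded verts_eq]] unfolding ends_def verts_eq by simp
  \<comment> \<open>The direction is opposite to that for vertices: the edge lies in the complement
    of \<open>{}\<close>, so it is the count at \<open>{}\<close> that merges classes.\<close>
  have "boundary_comps G {e} = num_classes (pts G) (block_rel (bclasses G))"
    "boundary_comps G {} = num_classes (pts G) (block_rel (bclasses G) \<union> e \<times> e)"
    using boundary_comps_alt[of "{}"] boundary_comps_alt[of "{e}"] single by simp_all
  moreover have mem': "x \<in> v \<longleftrightarrow> ?y \<in> v" "slot G x \<in> v \<longleftrightarrow> slot G ?y \<in> v" if "v \<in> bnds G" for v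
  proof -
    have "(x, ?y) \<in> bnd_rel G" "(slot G x, side G (slot G x)) \<in> bnd_rel G"
      using x_att by (auto simp: bnd_rel_def)
    moreover have "side G (slot G x) = slot G ?y" using side[OF x_att(1)] by simp
    ultimately show "x \<in> v \<longleftrightarrow> ?y \<in> v" "slot G x \<in> v \<longleftrightarrow> slot G ?y \<in> v"
      using component_mem_iff that pt unfolding bnds_eq by metis+
  qed
  moreover have ex': "e = {x, ?y, slot G x, slot G ?y}" by (subst ex) auto
  ultimately show "boundary_comps G {e} = boundary_comps G {} + (if same_class (bclasses G) (touching G e) then 0 else 1)"
    using num_classes_merge_classes[OF finite_pts partition_components part_b[unfolded bnds_eq]
        ex' edge_sub_pts[OF e] mem'[unfolded bnds_eq]] unfolding touching_def bnds_eq by simp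
qed

text \<open>Twice \<open>rho\<close> of the edge is 2 for a non-loop, 0 for an orientable loop and 1
  for a non-orientable one. The vertex colours decide whether a non-loop counts for the first or the
  second rank. For an orientable loop the missing 2 goes to the third or fourth rank according to
  the boundary colours. A non-orientable loop is split between the second and the fourth.\<close>

lemma single_edge_type:
  assumes single: "edges G = {e}"
  shows "\<exists>t. one_edge_type G e t" and "one_edge_type G e t \<Longrightarrow> increment G {} {e} t"
proof -
  have num_bnds: "num_bnds G {} = card (verts G)" "num_bnds G {e} = card (bnds G)"
    using num_bnds_empty num_bnds_edges single by simp_all
  have ends1: "same_class (vclasses G) (ends G e)" if "card (ends G e) = 1"
    by (rule same_class_single[OF part_v _ that]) (auto simp: ends_def)
  have touching1: "same_class (bclasses G) (touching G e)" if "card (touching G e) = 1"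
    by (rule same_class_single[OF part_b _ that]) (auto simp: touching_def)
  have q0: "rank1 G {} = 0" "rank2 G {} = 0" "rank3 G {} = 0" "rank4 G {} = 0"
    by (simp_all add: rank1_def rank2_def rank3_def rank4_def)
  note nums = increment_def q0 rank1_def[of G "{e}"] rank2_def[of G "{e}"] rank3_def[of G "{e}"] rank4_def[of G "{e}"]
    single_edge_comps[OF single] num_bnds
  have "(\<exists>t. one_edge_type G e t) \<and> (one_edge_type G e t \<longrightarrow> increment G {} {e} t)"
    using rg single
  proof (cases rule: one_edge_cases)
    case nonloop
    then have "\<not> loop G e" by (simp add: loop_def)
    then have "\<not> orientable_loop G e" "\<not> nonorientable_loop G e"
      by (simp_all add: orientable_loop_def nonorientable_loop_def)
    then have iff: "one_edge_type G e t \<longleftrightarrow> t = (if same_class (vclasses G) (ends G e) then Bp else Bs)" for t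
      using nonloop single by (cases t) (auto simp: one_edge_type_def)
    then show ?thesis using nonloop touching1[OF nonloop(2)] by (auto simp: nums)
  next
    case orientable
    then have "loop G e" by (simp add: orientable_loop_def)
    then have "card (ends G e) = 1" by (simp add: loop_def)
    then have iff: "one_edge_type G e t \<longleftrightarrow> t = (if same_class (bclasses G) (touching G e) then Olh else Olc)" for t
      using orientable single by (cases t) (auto simp: one_edge_type_def nonorientable_loop_def)
    then show ?thesis using orientable ends1 \<open>card (ends G e) = 1\<close> by (auto simp: nums)
  next
    case nonorientable
    then have "loop G e" "\<not> orientable_loop G e" by (simp_all add: nonorientable_loop_def)
    then have "card (ends G e) = 1" by (simp add: loop_def)
    then have iff: "one_edge_type G e t \<longleftrightarrow> t = Nl" for t
      using nonorientable single \<open>\<not> orientable_loop G e\<close> by (cases t) (auto simp: one_edge_type_def)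
    then show ?thesis using nonorientable ends1 touching1 \<open>card (ends G e) = 1\<close> by (auto simp: nums)
  qed
  then show "\<exists>t. one_edge_type G e t" "one_edge_type G e t \<Longrightarrow> increment G {} {e} t" by blast+
qed

text \<open>The counts of the minor at \<open>{}\<close> and \<open>{e}\<close> are those of
  \<open>G\<close> at \<open>edges G - {e}\<close> and \<open>edges G\<close>; the different base
  values cancel in the increment.\<close>

lemma contract_all_but:
  assumes "e \<in> edges G" "distinct fs" "set fs = edges G - {e}"
  shows "\<exists>t. one_edge_type (foldl contract G fs) e t"
    and "one_edge_type (foldl contract G fs) e t \<Longrightarrow> increment G (edges G - {e}) (edges G) t"
proof -
  have sub: "set fs \<subseteq> edges G" using assms by blast
  note H = foldl_contract[OF G assms(2) sub]
  let ?H = "foldl contract G fs"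
  interpret H: ribbon ?H by unfold_locales (rule H[THEN conjunct1])
  have single: "edges ?H = {e}" using H assms by auto
  have un: "{} \<union> set fs = edges G - {e}" "{e} \<union> set fs = edges G" using assms by auto
  have k: "vertex_comps ?H {} = vertex_comps G (edges G - {e})" "vertex_comps ?H {e} = vertex_comps G (edges G)"
    "boundary_comps ?H {} = boundary_comps G (edges G - {e})" "boundary_comps ?H {e} = boundary_comps G (edges G)"
    "num_bnds ?H {} = num_bnds G (edges G - {e})" "num_bnds ?H {e} = num_bnds G (edges G)"
    using H[THEN conjunct2, THEN conjunct2, rule_format, of "{}"] un assms(1,3)
      H[THEN conjunct2, THEN conjunct2, rule_format, of "{e}"] by simp_all
  have "card (edges G) = Suc (card (edges G - {e}))" using assms(1) finite_edges by (metis card_Suc_Diff1)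
  then have "increment ?H {} {e} t = increment G (edges G - {e}) (edges G) t"
    unfolding increment_def rank1_def rank2_def rank3_def rank4_def k by (simp add: algebra_simps)
  then show "\<exists>t. one_edge_type ?H e t" "one_edge_type ?H e t \<Longrightarrow> increment G (edges G - {e}) (edges G) t"
    using H.single_edge_type[OF single] by blast+
qed

lemma delete_all_but:
  assumes "e \<in> edges G" "distinct fs" "set fs = edges G - {e}"
  shows "\<exists>t. one_edge_type (foldl delete G fs) e t"
    and "one_edge_type (foldl delete G fs) e t \<Longrightarrow> increment G {} {e} t"
proof -
  have sub: "set fs \<subseteq> edges G" using assms by blast
  note H = foldl_delete[OF G assms(2) sub]
  let ?H = "foldl delete G fs"
  interpret H: ribbon ?H by unfold_locales (rule H[THEN conjunct1])
  have single: "edges ?H = {e}" using H assms by auto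
  have k: "vertex_comps ?H {} = vertex_comps G {}" "vertex_comps ?H {e} = vertex_comps G {e}" "boundary_comps ?H {} = boundary_comps G {}" "boundary_comps ?H {e} = boundary_comps G {e}"
    "num_bnds ?H {} = num_bnds G {}" "num_bnds ?H {e} = num_bnds G {e}"
    using H[THEN conjunct2, THEN conjunct2, rule_format, of "{}"] assms(1,3)
      H[THEN conjunct2, THEN conjunct2, rule_format, of "{e}"] by simp_all
  have "increment ?H {} {e} t = increment G {} {e} t"
    unfolding increment_def rank1_def rank2_def rank3_def rank4_def k by simp
  then show "\<exists>t. one_edge_type ?H e t" "one_edge_type ?H e t \<Longrightarrow> increment G {} {e} t"
    using H.single_edge_type[OF single] by blast+
qed

lemma edge_type_increment:
  assumes "edge_type G e i j"
  shows "increment G (edges G - {e}) (edges G) i" "increment G {} {e} j"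
proof -
  obtain cs ds where e: "e \<in> edges G"
    and cs: "distinct cs" "set cs = edges G - {e}" "one_edge_type (foldl contract G cs) e i"
    and ds: "distinct ds" "set ds = edges G - {e}" "one_edge_type (foldl delete G ds) e j"
    using assms unfolding edge_type_def by (elim conjE exE)
  show "increment G (edges G - {e}) (edges G) i" using contract_all_but(2)[OF e cs] .
  show "increment G {} {e} j" using delete_all_but(2)[OF e ds] .
qed

lemma edge_type_exists:
  assumes e: "e \<in> edges G" shows "\<exists>i j. edge_type G e i j"
proof -
  have "finite (edges G - {e})" using finite_edges by simp
  from finite_distinct_list[OF this]
  obtain fs where fs: "set fs = edges G - {e}" "distinct fs" by blast
  obtain i where "one_edge_type (foldl contract G fs) e i" using contract_all_but(1)[OF e fs(2,1)] ..
  moreover obtain j where "one_edge_type (foldl delete G fs) e j" using delete_all_but(1)[OF e fs(2,1)] ..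
  ultimately show ?thesis using e fs unfolding edge_type_def by (intro exI conjI)
qed

end

text \<open>Deleting all edges outside \<open>insert e A\<close> keeps the counts and makes
  \<open>e\<close> the last edge to be added, so its contraction type in that minor is the required
  one.\<close>

lemma increment_insert:
  assumes G: "coloured_ribbon_graph G" and "e \<in> edges G" "A \<subseteq> edges G" "e \<notin> A"
  shows "\<exists>t. increment G A (insert e A) t"
proof -
  interpret ribbon G by unfold_locales (rule G)
  have "finite (edges G - insert e A)" using finite_edges by simp
  from finite_distinct_list[OF this]
  obtain ds where ds: "distinct ds" "set ds = edges G - insert e A" by blast
  have sub: "set ds \<subseteq> edges G" using ds by auto
  let ?H = "foldl delete G ds"
  note H = foldl_delete[OF G ds(1) sub]
  interpret H: ribbon ?H by unfold_locales (rule H[THEN conjunct1])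
  have E: "edges ?H = insert e A" using H ds assms by auto
  then have "e \<in> edges ?H" by simp
  then obtain i where i: "increment ?H (edges ?H - {e}) (edges ?H) i"
    using H.edge_type_exists H.edge_type_increment by blast
  have "edges ?H - {e} = A" using E assms by auto
  then have i: "increment ?H A (insert e A) i" using i E by simp
  have "B \<subseteq> edges G - set ds" if "B \<subseteq> insert e A" for B using that ds assms by auto
  then have k: "vertex_comps ?H B = vertex_comps G B" "boundary_comps ?H B = boundary_comps G B" "num_bnds ?H B = num_bnds G B" if "B \<subseteq> insert e A" for B
    using H[THEN conjunct2, THEN conjunct2, rule_format, of B] that by simp_all
  have "increment ?H A (insert e A) i = increment G A (insert e A) i"
    unfolding increment_def rank1_def rank2_def rank3_def rank4_def
    by (simp only: k[of "{}"] k[of A] k[of "insert e A"] empty_subsetI subset_insertI order_refl)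
  then show ?thesis using i by blast
qed

text \<open>All increments are nonnegative. This makes every \<open>nat\<close> in
  \<open>state_weight\<close> exact.\<close>

lemma rank_mono:
  assumes G: "coloured_ribbon_graph G" and "A \<subseteq> B" "B \<subseteq> edges G"
  shows "rank1 G A \<le> rank1 G B \<and> rank2 G A \<le> rank2 G B \<and> rank3 G A \<le> rank3 G B \<and> rank4 G A \<le> rank4 G B"
proof -
  interpret ribbon G by unfold_locales (rule G)
  have fin: "finite (B - A)" using finite_subset[OF assms(3) finite_edges] by simp
  have "rank1 G A \<le> rank1 G (A \<union> D) \<and> rank2 G A \<le> rank2 G (A \<union> D) \<and> rank3 G A \<le> rank3 G (A \<union> D) \<and> rank4 G A \<le> rank4 G (A \<union> D)"
    if "finite D" "D \<subseteq> B - A" for D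
    using that
  proof (induction D)
    case (insert e D)
    then have "e \<in> edges G" "A \<union> D \<subseteq> edges G" "e \<notin> A \<union> D" using assms by auto
    then obtain t where "increment G (A \<union> D) (insert e (A \<union> D)) t" using increment_insert[OF G] by blast
    then show ?case using insert by (auto simp: increment_def)
  qed simp
  from this[OF fin order_refl] show ?thesis using assms(2) by (simp add: Un_absorb1)
qed

section \<open>The state sum\<close>

lemma U_ring_one: "1 \<in> U_ring"
  by (simp add: U_ring_def flip: single_one)

lemma U_ring_zero: "0 \<in> U_ring"
  by (simp add: U_ring_def)

lemma U_ring_indet: "x \<noteq> Sqrt_gamma \<Longrightarrow> indet x \<in> U_ring"
  by (simp add: U_ring_def indet_def lookup_single)

lemma U_ring_gamma: "gamma \<in> U_ring"
proof -
  have "gamma = Poly_Mapping.single (Poly_Mapping.single Sqrt_gamma 2) 1"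
    by (simp add: indet_def power2_eq_square mult_single numeral_2_eq_2 flip: single_add)
  then show ?thesis by (simp add: U_ring_def)
qed

lemma U_ring_add: "p \<in> U_ring \<Longrightarrow> q \<in> U_ring \<Longrightarrow> p + q \<in> U_ring"
  unfolding U_ring_def using keys_add[of p q] by blast

lemma U_ring_mult:
  assumes "p \<in> U_ring" "q \<in> U_ring" shows "p * q \<in> U_ring"
  unfolding U_ring_def
proof (intro CollectI ballI)
  fix m assume "m \<in> Poly_Mapping.keys (p * q)"
  then obtain a b where "m = a + b" "a \<in> Poly_Mapping.keys p" "b \<in> Poly_Mapping.keys q"
    using keys_mult[of p q] by blast
  then show "even (Poly_Mapping.lookup m Sqrt_gamma)"
    using assms by (simp add: U_ring_def lookup_add)
qed

lemma U_ring_power: "p \<in> U_ring \<Longrightarrow> p ^ n \<in> U_ring"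
  by (induction n) (simp_all add: U_ring_one U_ring_mult)

lemma U_ring_sum: "(\<And>a. a \<in> A \<Longrightarrow> f a \<in> U_ring) \<Longrightarrow> sum f A \<in> U_ring"
  by (induction A rule: infinite_finite_induct) (simp_all add: U_ring_add U_ring_zero)

text \<open>This is one term of the formula with its prefactor, after cancellation. The exponents of
  \<open>alpha\<close> and \<open>beta\<close> combine to component counts at \<open>A\<close>. The
  exponent of \<open>gamma\<close> is \<open>card (verts G)\<close> - r1 - r2 + r3 + r4 at
  \<open>A\<close>, that is \<open>card (verts G)\<close> + \<open>card A\<close> - 2
  \<open>rho G A\<close>, which is \<open>num_bnds G A\<close>. So no denominators and no odd powers
  of \<open>sqrt_gamma\<close> remain.\<close>

definition state_weight :: "'p coloured_ribbon_graph \<Rightarrow> 'p set set \<Rightarrow> upoly" where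
  "state_weight G A = alpha ^ vertex_comps G A * beta ^ boundary_comps G A * gamma ^ num_bnds G A
     * (a_bs ^ nat (rank1 G (edges G) - rank1 G A) * sqrt_a_bp ^ nat (rank2 G (edges G) - rank2 G A)
        * a_olc ^ nat (rank3 G (edges G) - rank3 G A) * sqrt_a_olh ^ nat (rank4 G (edges G) - rank4 G A))
     * (b_bs ^ nat (rank1 G A) * sqrt_b_bp ^ nat (rank2 G A) * b_olc ^ nat (rank3 G A) * sqrt_b_olh ^ nat (rank4 G A))"

definition state_sum :: "'p coloured_ribbon_graph \<Rightarrow> upoly" where
  "state_sum G = (\<Sum>A\<in>Pow (edges G). state_weight G A)"

lemma state_sum_in_U_ring: "state_sum G \<in> U_ring"
  unfolding state_sum_def state_weight_def
  by (intro U_ring_sum U_ring_mult U_ring_power U_ring_indet U_ring_gamma) simp_all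

lemma coeff_a_alt: "coeff_a t = a_bs ^ type_rank1 t * sqrt_a_bp ^ type_rank2 t * a_olc ^ type_rank3 t * sqrt_a_olh ^ type_rank4 t"
  by (cases t) simp_all

lemma coeff_b_alt: "coeff_b t = b_bs ^ type_rank1 t * sqrt_b_bp ^ type_rank2 t * b_olc ^ type_rank3 t * sqrt_b_olh ^ type_rank4 t"
  by (cases t) simp_all

lemma rank_empty [simp]: "rank1 G {} = 0" "rank2 G {} = 0" "rank3 G {} = 0" "rank4 G {} = 0"
  by (simp_all add: rank1_def rank2_def rank3_def rank4_def)

section \<open>The recursion for the state sum\<close>

context ribbon
begin

lemma vertex_comps_empty: "vertex_comps G {} = card (vclasses G)"
  by (simp add: vertex_comps_def mcomponents_def vertex_quotient_def num_classes_empty)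

lemma boundary_comps_edges: "boundary_comps G (edges G) = card (bclasses G)"
  by (simp add: boundary_comps_def mcomponents_def boundary_quotient_def num_classes_empty)

lemma state_sum_edgeless:
  assumes "edges G = {}"
  shows "state_sum G = alpha ^ card (vclasses G) * beta ^ card (bclasses G) * gamma ^ card (verts G)"
  using vertex_comps_empty boundary_comps_edges num_bnds_empty assms by (simp add: state_sum_def state_weight_def)

lemma rank_delete:
  assumes e: "e \<in> edges G" and A: "A \<subseteq> edges G - {e}"
  shows "rank1 (delete G e) A = rank1 G A" "rank2 (delete G e) A = rank2 G A"
    "rank3 (delete G e) A = rank3 G A" "rank4 (delete G e) A = rank4 G A"
proof -
  have "e \<notin> A" using A by blast
  then show "rank1 (delete G e) A = rank1 G A" "rank2 (delete G e) A = rank2 G A"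
    "rank3 (delete G e) A = rank3 G A" "rank4 (delete G e) A = rank4 G A"
    by (simp_all add: rank1_def rank2_def rank3_def rank4_def vertex_comps_delete num_bnds_delete boundary_comps_delete[OF e])
qed

text \<open>The base value of each count in the contraction, at \<open>{}\<close>, is the value of
  \<open>G\<close> at \<open>{e}\<close>, so ranks of the contraction are measured from
  there.\<close>

lemma rank_contract:
  assumes e: "e \<in> edges G" and A: "A \<subseteq> edges G - {e}"
  shows "rank1 G (insert e A) = rank1 G {e} + rank1 (contract G e) A" "rank2 G (insert e A) = rank2 G {e} + rank2 (contract G e) A"
    "rank3 G (insert e A) = rank3 G {e} + rank3 (contract G e) A" "rank4 G (insert e A) = rank4 G {e} + rank4 (contract G e) A"
proof -
  have "finite A" "e \<notin> A" using A finite_edges finite_subset by auto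
  then have "card (insert e A) = Suc (card A)" by simp
  then show "rank1 G (insert e A) = rank1 G {e} + rank1 (contract G e) A" "rank2 G (insert e A) = rank2 G {e} + rank2 (contract G e) A"
    "rank3 G (insert e A) = rank3 G {e} + rank3 (contract G e) A" "rank4 G (insert e A) = rank4 G {e} + rank4 (contract G e) A"
    by (simp_all add: rank1_def rank2_def rank3_def rank4_def vertex_comps_contract[OF e A] num_bnds_contract[OF e A] boundary_comps_contract[OF e]
        vertex_comps_contract[OF e, of "{}"] num_bnds_contract[OF e, of "{}"])
qed

text \<open>Only the exponents of the \<open>a\<close> generators notice the deletion: they measure
  the distance from \<open>A\<close> to the full edge set, which loses its last step, of type
  \<open>t\<close>.\<close>

lemma state_weight_delete:
  assumes inc: "increment G (edges G - {e}) (edges G) t" and e: "e \<in> edges G" and A: "A \<subseteq> edges G - {e}"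
  shows "state_weight G A = coeff_a t * state_weight (delete G e) A"
proof -
  have n: "nat (a + int w - b) = w + nat (a - b)" if "b \<le> a" for a b w using that by simp
  have E: "edges (delete G e) = edges G - {e}" by (rule edges_delete[OF e])
  have "e \<notin> A" using A by blast
  have "nat (rank1 G (edges G) - rank1 G A) = type_rank1 t + nat (rank1 G (edges G - {e}) - rank1 G A)"
    "nat (rank2 G (edges G) - rank2 G A) = type_rank2 t + nat (rank2 G (edges G - {e}) - rank2 G A)"
    "nat (rank3 G (edges G) - rank3 G A) = type_rank3 t + nat (rank3 G (edges G - {e}) - rank3 G A)"
    "nat (rank4 G (edges G) - rank4 G A) = type_rank4 t + nat (rank4 G (edges G - {e}) - rank4 G A)"
    using inc rank_mono[OF G A] n unfolding increment_def by (metis Diff_subset)+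
  then show ?thesis
    unfolding state_weight_def E coeff_a_alt rank_delete[OF e A] rank_delete[OF e order_refl]
      vertex_comps_delete num_bnds_delete boundary_comps_delete[OF e \<open>e \<notin> A\<close>]
    by (simp only: power_add mult_ac)
qed

text \<open>Only the exponents of the \<open>b\<close> generators change: they measure the distance
  from \<open>{}\<close>, which loses its first step. In the distance to the full edge set the ranks
  of \<open>{e}\<close> cancel.\<close>

lemma state_weight_contract:
  assumes inc: "increment G {} {e} t" and e: "e \<in> edges G" and A: "A \<subseteq> edges G - {e}"
  shows "state_weight G (insert e A) = coeff_b t * state_weight (contract G e) A"
proof -
  interpret c: ribbon "contract G e" by unfold_locales (rule coloured_contract[OF e])
  have E: "edges (contract G e) = edges G - {e}" "insert e (edges G - {e}) = edges G"
    using edges_contract[OF e] e by auto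
  have q: "rank1 G {e} = int (type_rank1 t)" "rank2 G {e} = int (type_rank2 t)" "rank3 G {e} = int (type_rank3 t)" "rank4 G {e} = int (type_rank4 t)"
    using inc by (simp_all add: increment_def)
  note qi = rank_contract[OF e A] and qE = rank_contract[OF e order_refl, unfolded E(2)]
  have "0 \<le> rank1 (contract G e) A" "0 \<le> rank2 (contract G e) A" "0 \<le> rank3 (contract G e) A" "0 \<le> rank4 (contract G e) A"
    using rank_mono[OF c.G, of "{}" A] A by (simp_all add: E)
  then have "nat (rank1 G (insert e A)) = type_rank1 t + nat (rank1 (contract G e) A)"
    "nat (rank2 G (insert e A)) = type_rank2 t + nat (rank2 (contract G e) A)"
    "nat (rank3 G (insert e A)) = type_rank3 t + nat (rank3 (contract G e) A)"
    "nat (rank4 G (insert e A)) = type_rank4 t + nat (rank4 (contract G e) A)"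
    unfolding qi q by simp_all
  moreover have "rank1 G (edges G) - rank1 G (insert e A) = rank1 (contract G e) (edges G - {e}) - rank1 (contract G e) A"
    "rank2 G (edges G) - rank2 G (insert e A) = rank2 (contract G e) (edges G - {e}) - rank2 (contract G e) A"
    "rank3 G (edges G) - rank3 G (insert e A) = rank3 (contract G e) (edges G - {e}) - rank3 (contract G e) A"
    "rank4 G (edges G) - rank4 G (insert e A) = rank4 (contract G e) (edges G - {e}) - rank4 (contract G e) A"
    unfolding qi qE by simp_all
  ultimately show ?thesis
    unfolding state_weight_def E coeff_b_alt vertex_comps_contract[OF e A] num_bnds_contract[OF e A] boundary_comps_contract[OF e]
    by (simp only: power_add mult_ac)
qed

lemma state_sum_recursion:
  assumes "edge_type G e i j"
  shows "state_sum G = coeff_a i * state_sum (delete G e) + coeff_b j * state_sum (contract G e)"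
proof -
  have e: "e \<in> edges G" using assms by (simp add: edge_type_def)
  note inc = edge_type_increment[OF assms]
  let ?P = "Pow (edges G - {e})"
  have "edges G = insert e (edges G - {e})" using e by blast
  then have "Pow (edges G) = ?P \<union> insert e ` ?P" using Pow_insert by metis
  moreover have "?P \<inter> insert e ` ?P = {}" by blast
  moreover have "inj_on (insert e) ?P"
  proof (rule inj_onI)
    fix A B assume "A \<in> ?P" "B \<in> ?P" "insert e A = insert e B"
    then have "e \<notin> A" "e \<notin> B" by blast+
    then show "A = B" using \<open>insert e A = insert e B\<close> by (simp add: insert_ident)
  qed
  moreover have "finite ?P" using finite_edges by simp
  ultimately have "state_sum G = (\<Sum>A\<in>?P. state_weight G A) + (\<Sum>A\<in>?P. state_weight G (insert e A))"
    unfolding state_sum_def by (simp add: sum.union_disjoint sum.reindex)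
  also have "(\<Sum>A\<in>?P. state_weight G A) = coeff_a i * state_sum (delete G e)"
    unfolding state_sum_def sum_distrib_left edges_delete[OF e]
    by (rule sum.cong) (simp_all add: state_weight_delete[OF inc(1) e])
  also have "(\<Sum>A\<in>?P. state_weight G (insert e A)) = coeff_b j * state_sum (contract G e)"
    unfolding state_sum_def sum_distrib_left edges_contract[OF e]
    by (rule sum.cong) (simp_all add: state_weight_contract[OF inc(2) e])
  finally show ?thesis .
qed

end

lemma U_recursion_state_sum: "U_recursion state_sum"
  unfolding U_recursion_def
  using state_sum_in_U_ring ribbon.state_sum_recursion ribbon.state_sum_edgeless ribbon.intro by blast

text \<open>Every edge has a type, so the recursion reduces any graph with edges to two graphs with
  one edge less.\<close>

lemma U_recursion_unique:
  assumes U: "U_recursion U" and "coloured_ribbon_graph G"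
  shows "U G = state_sum G"
  using assms(2)
proof (induction "card (edges G)" arbitrary: G rule: less_induct)
  case less
  interpret ribbon G by unfold_locales (rule less.prems)
  show ?case
  proof (cases "edges G = {}")
    case True
    then have "U G = alpha ^ card (vclasses G) * beta ^ card (bclasses G) * gamma ^ card (verts G)"
      using U G unfolding U_recursion_def by metis
    then show ?thesis using state_sum_edgeless[OF True] by simp
  next
    case False
    then obtain e where e: "e \<in> edges G" by blast
    then obtain i j where ij: "edge_type G e i j" using edge_type_exists by blast
    have "card (edges G - {e}) < card (edges G)" by (rule card_Diff1_less[OF finite_edges e])
    then have "U (delete G e) = state_sum (delete G e)" "U (contract G e) = state_sum (contract G e)"
      using less.hyps coloured_delete[OF e] coloured_contract[OF e] edges_delete[OF e] edges_contract[OF e]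
      by simp_all
    moreover have "U G = coeff_a i * U (delete G e) + coeff_b j * U (contract G e)"
      using U G ij unfolding U_recursion_def by metis
    ultimately show ?thesis using state_sum_recursion[OF ij] by simp
  qed
qed

section \<open>Comparison with the formula in the fraction field\<close>

lemma to_fract_power: "to_fract (x ^ n) = to_fract x ^ n"
  by (induction n) simp_all

lemma indet_nonzero: "indet x \<noteq> 0"
  by (simp add: indet_def)

text \<open>Here \<open>g\<close> is the square root of gamma, the n are the ranks at
  \<open>A\<close> and the m what is missing to the ranks of all edges, with second and fourth ranks
  doubled. The last assumption is the balance of the exponents of \<open>g\<close>, arranged so that
  it needs no subtraction.\<close>

lemma weight_identity:
  fixes al be g ab sp ao sq bb tp bo tq :: "'k::field"
  assumes nz: "al \<noteq> 0" "g \<noteq> 0" "ab \<noteq> 0" "sp \<noteq> 0" "ao \<noteq> 0" "sq \<noteq> 0"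
    and g: "2 * v + 2 * n3 + n4 = 2 * b + 2 * n1 + n2"
  shows "al ^ k * be ^ f * (g ^ 2) ^ v * (al * ab) ^ (n1 + m1) * sp ^ (n2 + m2) * ao ^ (n3 + m3) * sq ^ (n4 + m4)
      * ((bb / (al * g ^ 2 * ab)) ^ n1 * (tp / (g * sp)) ^ n2 * (be * g ^ 2 * bo / ao) ^ n3 * (g * tq / sq) ^ n4)
    = al ^ (k + m1) * be ^ (f + n3) * (g ^ 2) ^ b * (ab ^ m1 * sp ^ m2 * ao ^ m3 * sq ^ m4)
      * (bb ^ n1 * tp ^ n2 * bo ^ n3 * tq ^ n4)"
proof -
  \<comment> \<open>All powers of \<open>g\<close> are collected here; every other base cancels
    within its own factor.\<close>
  have "(g ^ 2) ^ v * (g ^ 2) ^ n3 * g ^ n4 = (g ^ 2) ^ b * ((g ^ 2) ^ n1 * g ^ n2)"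
    using g by (simp add: add.assoc flip: power_mult power_add)
  moreover have "(g ^ 2) ^ n1 * g ^ n2 \<noteq> 0" using nz by simp
  ultimately have G: "(g ^ 2) ^ v * (g ^ 2) ^ n3 * g ^ n4 / ((g ^ 2) ^ n1 * g ^ n2) = (g ^ 2) ^ b"
    by (simp add: nonzero_divide_eq_eq)
  have eqs: "(al * ab) ^ (n1 + m1) * (bb / (al * g ^ 2 * ab)) ^ n1 = al ^ m1 * ab ^ m1 * bb ^ n1 / (g ^ 2) ^ n1"
    "sp ^ (n2 + m2) * (tp / (g * sp)) ^ n2 = sp ^ m2 * tp ^ n2 / g ^ n2"
    "ao ^ (n3 + m3) * (be * g ^ 2 * bo / ao) ^ n3 = ao ^ m3 * (be ^ n3 * (g ^ 2) ^ n3 * bo ^ n3)"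
    "sq ^ (n4 + m4) * (g * tq / sq) ^ n4 = sq ^ m4 * (g ^ n4 * tq ^ n4)"
    using nz by (simp_all add: power_add power_mult_distrib power_divide)
  have "al ^ k * be ^ f * (g ^ 2) ^ v * (al * ab) ^ (n1 + m1) * sp ^ (n2 + m2) * ao ^ (n3 + m3) * sq ^ (n4 + m4)
      * ((bb / (al * g ^ 2 * ab)) ^ n1 * (tp / (g * sp)) ^ n2 * (be * g ^ 2 * bo / ao) ^ n3 * (g * tq / sq) ^ n4)
    = al ^ k * be ^ f * (g ^ 2) ^ v * ((al * ab) ^ (n1 + m1) * (bb / (al * g ^ 2 * ab)) ^ n1)
      * (sp ^ (n2 + m2) * (tp / (g * sp)) ^ n2) * (ao ^ (n3 + m3) * (be * g ^ 2 * bo / ao) ^ n3)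
      * (sq ^ (n4 + m4) * (g * tq / sq) ^ n4)"
    by (simp only: mult_ac)
  also have "\<dots> = al ^ k * be ^ f * (g ^ 2) ^ v * (al ^ m1 * ab ^ m1 * bb ^ n1 / (g ^ 2) ^ n1) * (sp ^ m2 * tp ^ n2 / g ^ n2)
      * (ao ^ m3 * (be ^ n3 * (g ^ 2) ^ n3 * bo ^ n3)) * (sq ^ m4 * (g ^ n4 * tq ^ n4))"
    unfolding eqs ..
  also have "\<dots> = al ^ k * al ^ m1 * (be ^ f * be ^ n3) * ((g ^ 2) ^ v * (g ^ 2) ^ n3 * g ^ n4 / ((g ^ 2) ^ n1 * g ^ n2))
      * (ab ^ m1 * sp ^ m2 * ao ^ m3 * sq ^ m4) * (bb ^ n1 * tp ^ n2 * bo ^ n3 * tq ^ n4)"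
    by (simp add: mult_ac)
  finally show ?thesis unfolding G by (simp add: power_add)
qed

context ribbon
begin

lemma r1_eq: "r1 G A = rank1 G A"
  using vertex_comps_empty by (simp add: r1_def graph_rank_def rank1_def vertex_comps_def vertex_quotient_def)

lemma r3_eq: "r3 G A = rank3 G A"
  by (simp add: r3_def graph_rank_def rank3_def boundary_comps_def)

lemma rho_eq: "2 * rho G A = of_int (int (card A) + int (num_bnds G {}) - int (num_bnds G A))"
  by (simp add: rho_def num_bnds_def flip: num_bnds_empty)

lemma r2_eq: "2 * r2 G A = of_int (rank2 G A)"
proof -
  have "2 * r2 G A = 2 * rho G A - 2 * of_int (rank1 G A)"
    unfolding r2_def r1_eq[symmetric] r1_def by (simp add: algebra_simps)
  then show ?thesis unfolding rho_eq rank2_def by simp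
qed

lemma r4_eq: "2 * r4 G A = of_int (rank4 G A)"
proof -
  have "2 * r4 G A = 2 * of_nat (card A) - 2 * of_int (rank3 G A) - 2 * rho G A"
    unfolding r4_def r3_eq[symmetric] r3_def by (simp add: algebra_simps)
  then show ?thesis unfolding rho_eq rank4_def by simp
qed

text \<open>The doubled ranks are integers, so the floor in \<open>half_pow\<close> loses
  nothing.\<close>

lemma half_pow_eq:
  "half_pow s (r2 G A) = s powi rank2 G A" "half_pow s (r4 G A) = s powi rank4 G A"
  unfolding half_pow_def r2_eq r4_eq by simp_all

lemma fr_state_weight:
  assumes A: "A \<subseteq> edges G"
  shows "fr alpha ^ num_components (vertex_quotient G) *
       fr beta ^ num_components (boundary_quotient G) *
       fr gamma ^ card (verts G) *
       (fr alpha * fr a_bs) powi r1 G (edges G) *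
       half_pow (fr sqrt_a_bp) (r2 G (edges G)) *
       fr a_olc powi r3 G (edges G) *
       half_pow (fr sqrt_a_olh) (r4 G (edges G)) *
       ((fr b_bs / (fr alpha * fr gamma * fr a_bs)) powi r1 G A *
          half_pow (fr sqrt_b_bp / (fr sqrt_gamma * fr sqrt_a_bp)) (r2 G A) *
          (fr beta * fr gamma * fr b_olc / fr a_olc) powi r3 G A *
          half_pow (fr sqrt_gamma * fr sqrt_b_olh / fr sqrt_a_olh) (r4 G A)) = fr (state_weight G A)"
proof -
  define n1 n2 n3 n4 where n: "n1 = nat (rank1 G A)" "n2 = nat (rank2 G A)" "n3 = nat (rank3 G A)" "n4 = nat (rank4 G A)"
  define m1 m2 m3 m4 where m: "m1 = nat (rank1 G (edges G) - rank1 G A)" "m2 = nat (rank2 G (edges G) - rank2 G A)"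
    "m3 = nat (rank3 G (edges G) - rank3 G A)" "m4 = nat (rank4 G (edges G) - rank4 G A)"
  have qA: "rank1 G A = int n1" "rank2 G A = int n2" "rank3 G A = int n3" "rank4 G A = int n4"
    using rank_mono[OF G empty_subsetI A] by (simp_all add: n)
  have qE: "rank1 G (edges G) = int (n1 + m1)" "rank2 G (edges G) = int (n2 + m2)"
    "rank3 G (edges G) = int (n3 + m3)" "rank4 G (edges G) = int (n4 + m4)"
    using rank_mono[OF G A order_refl] qA by (simp_all add: m)
  \<comment> \<open>The number of components of the vertex quotient is the count at
    \<open>edges G\<close>, so the difference to \<open>A\<close> is the missing rank
    \<open>m1\<close>. For the boundary quotient it is the count at \<open>{}\<close>, whence
    \<open>n3\<close> below.\<close>
  have vertex_comps: "vertex_comps G A = num_components (vertex_quotient G) + m1"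
    using qA(1) qE(1) by (simp add: rank1_def num_components_def vertex_comps_def vertex_quotient_def)
  have boundary_comps: "boundary_comps G A = num_components (boundary_quotient G) + n3"
    using qA(3) by (simp add: rank3_def num_components_def boundary_comps_def boundary_quotient_def)
  \<comment> \<open>Subtracting the definitions of the doubled ranks \<open>rank2\<close> and
    \<open>rank4\<close> eliminates \<open>card A\<close>.\<close>
  have g: "2 * card (verts G) + 2 * n3 + n4 = 2 * num_bnds G A + 2 * n1 + n2"
    using qA rank2_def[of G A] rank4_def[of G A] num_bnds_empty by linarith
  have nz: "fr (indet x) \<noteq> 0" for x by (simp add: indet_nonzero)
  show ?thesis
    unfolding r1_eq r3_eq half_pow_eq qA qE power_int_of_nat to_fract_power
    unfolding state_weight_def n[symmetric] m[symmetric] vertex_comps boundary_comps to_fract_mult to_fract_power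
    by (rule weight_identity[OF nz nz nz nz nz nz g])
qed

end

theorem theorem3p4:
  "(\<exists>U :: 'p coloured_ribbon_graph \<Rightarrow> upoly. U_recursion U) \<and>
   (\<forall>(U :: 'p coloured_ribbon_graph \<Rightarrow> upoly) G. U_recursion U \<and> coloured_ribbon_graph G \<longrightarrow>
     fr (U G) =
       fr alpha ^ num_components (vertex_quotient G) *
       fr beta ^ num_components (boundary_quotient G) *
       fr gamma ^ card (verts G) *
       (fr alpha * fr a_bs) powi r1 G (edges G) *
       half_pow (fr sqrt_a_bp) (r2 G (edges G)) *
       fr a_olc powi r3 G (edges G) *
       half_pow (fr sqrt_a_olh) (r4 G (edges G)) *
       (\<Sum>A\<in>Pow (edges G).
          (fr b_bs / (fr alpha * fr gamma * fr a_bs)) powi r1 G A *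
          half_pow (fr sqrt_b_bp / (fr sqrt_gamma * fr sqrt_a_bp)) (r2 G A) *
          (fr beta * fr gamma * fr b_olc / fr a_olc) powi r3 G A *
          half_pow (fr sqrt_gamma * fr sqrt_b_olh / fr sqrt_a_olh) (r4 G A)))"
proof (intro conjI allI impI)
  show "\<exists>U :: 'p coloured_ribbon_graph \<Rightarrow> upoly. U_recursion U" using U_recursion_state_sum by blast
next
  fix U :: "'p coloured_ribbon_graph \<Rightarrow> upoly" and G :: "'p coloured_ribbon_graph"
  assume *: "U_recursion U \<and> coloured_ribbon_graph G"
  then interpret ribbon G by unfold_locales simp
  have "U G = state_sum G" using * U_recursion_unique by blast
  then have "fr (U G) = (\<Sum>A\<in>Pow (edges G). fr (state_weight G A))"
    by (simp add: state_sum_def)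
  then show "fr (U G) =
       fr alpha ^ num_components (vertex_quotient G) *
       fr beta ^ num_components (boundary_quotient G) *
       fr gamma ^ card (verts G) *
       (fr alpha * fr a_bs) powi r1 G (edges G) *
       half_pow (fr sqrt_a_bp) (r2 G (edges G)) *
       fr a_olc powi r3 G (edges G) *
       half_pow (fr sqrt_a_olh) (r4 G (edges G)) *
       (\<Sum>A\<in>Pow (edges G).
          (fr b_bs / (fr alpha * fr gamma * fr a_bs)) powi r1 G A *
          half_pow (fr sqrt_b_bp / (fr sqrt_gamma * fr sqrt_a_bp)) (r2 G A) *
          (fr beta * fr gamma * fr b_olc / fr a_olc) powi r3 G A *
          half_pow (fr sqrt_gamma * fr sqrt_b_olh / fr sqrt_a_olh) (r4 G A))"
    unfolding sum_distrib_left
    by (simp only:) (rule sum.cong[OF refl], simp only: Pow_iff fr_state_weight)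
qed

end
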